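(* Assume that $(H_1)$, $(H_1^{\mathcal A})$, $(H_2^{\mathcal A})$ and $(H_3^{\mathcal A})$ (as stated in the context) hold, with activation functions $g_i$ of class $\mathcal A$. Then for each $\Sigma\in\{1,2\}^N$ there exists a unique almost periodic solution of (GNN) which is exponentially stable in $\mathcal K^\Sigma$.
   Context: **System.** Let $N,M\ge1$ be integers; indices satisfy $i,j\in\{1,\dots,N\}$, $l\in\{1,\dots,M\}$. The general neural network (GNN) is $$\frac{du^i(t)}{dt}=-c_i(t)u^i(t)+\sum_{l=1}^M\sum_{j=1}^N a_{ijl}(t)\,g_j\big(\sigma_j u^j(t-\kappa_{ijl}(t))\big)+J_i(t),\qquad i=1,\dots,N. \tag{GNN}$$ The delays satisfy $0<\kappa_{ijl}(t)\le\kappa_{ijl}$ with constants $\kappa_{ijl}$, and $\kappa:=\max_{i,j,l}\kappa_{ijl}$. For $\phi\in C([-\kappa,0],\mathbb R^N)$, $u(t;\phi)$ denotes the solution of (GNN) for $t\ge0$ with $u(s;\phi)=\phi(s)$ on $[-\kappa,0]$; for a function $u$ write $u_t(s)=u(t+s)$, $s\in[-\kappa,0]$. The norm is $\|\phi\|_\kappa=\max_i\sup_{s\in[-\kappa,0]}|\phi^i(s)|$. **Almost periodic** is in the sense of Bohr: a continuous $f:\mathbb R\to\mathbb R$ such that for each $\epsilon>0$ the set $\{T:|f(t+T)-f(t)|<\epsilon\ \forall t\in\mathbb R\}$ is relatively dense. A vector function is almost periodic if each component is. **$(H_1)$**: $c_i(t)>0$, $a_{ijl}(t)$, $\kappa_{ijl}(t)>0$,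 $J_i(t)$ are almost periodic functions on $\mathbb R$; $\sigma_j>0$ are constants; $a_{iil}(t)>0$. **Class $\mathcal A$**: $g_i\in C^2(\mathbb R)$, $|g_i(x)|\le B_i$ for a constant $B_i$, $g_i(0)=0$, $\dot g_i(x)>0$ for all $x\in\mathbb R$, and $x\ddot g_i(x)<0$ for all $x\ne0$. **Auxiliary functions**: $F_i(z)=-\big(\sup_{t}c_i(t)\big)z+\big(\inf_{t}\sum_{l=1}^M a_{iil}(t)\big)g_i(\sigma_i z)$. All $\sup$ and $\inf$ over $t$ are over $t\in\mathbb R$. **$(H_1^{\mathcal A})$**: for every $i$, $$\inf_{\zeta\in\mathbb R}\dot g_i(\zeta)<\frac{\sup_t c_i(t)}{\sigma_i\inf_t\sum_{l=1}^M a_{iil}(t)}<\sup_{\zeta\in\mathbb R}\dot g_i(\zeta)$$ (in particular $\inf_t\sum_l a_{iil}(t)>0$). Under this condition $\dot F_i$ has exactly two zeros $z_{i1}<0<z_{i2}$. **$(H_2^{\mathcal A})$**: for every $i$, $k=1,2$ and all $t\in\mathbb R$, $$(-1)^k\{F_i(z_{ik})+J_i(t)\}>\sum_{l=1}^M\sum_{j\ne i}\sup_{t}|a_{ijl}(t)|B_j .$$ **Basins**: $\beta_{i1}:=\hat z_{i1}$ is the point $\hat z_{i1}<z_{i1}$ with $F_i(\hat z_{i1})+\sum_{l}\sum_{j\ne i}\sup_t|a_{ijl}(t)|B_j+\sup_tJ_i(t)=0$; $\alpha_{i2}:=\tilde z_{i2}$ is the point $\tilde z_{i2}>z_{i2}$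 with $F_i(\tilde z_{i2})-\sum_{l}\sum_{j\ne i}\sup_t|a_{ijl}(t)|B_j+\inf_tJ_i(t)=0$. Set $$\mathcal K_{i1}=\{\psi\in C([-\kappa,0],\mathbb R):\psi(s)\le\beta_{i1}\ \forall s\},\qquad \mathcal K_{i2}=\{\psi\in C([-\kappa,0],\mathbb R):\psi(s)\ge\alpha_{i2}\ \forall s\},$$ and $\mathcal K^\Sigma=\mathcal K_{1\varsigma_1}\times\cdots\times\mathcal K_{N\varsigma_N}$ for $\Sigma=(\varsigma_1,\dots,\varsigma_N)\in\{1,2\}^N$. **$(H_3^{\mathcal A})$**: $\mathcal C-\mathcal H\mathcal G\in\mathcal M$, where $\mathcal C=\mathrm{diag}(\inf_tc_1(t),\dots,\inf_tc_N(t))$, $\mathcal H=(\hbar_{ij})_{N\times N}$ with $\hbar_{ij}=\sum_{l=1}^M\sup_t|a_{ijl}(t)|$, $\mathcal G=\mathrm{diag}(\sigma_1\gamma_1,\dots,\sigma_N\gamma_N)$ with $\gamma_i=\max\{\dot g_i(\sigma_i\beta_{i1}),\dot g_i(\sigma_i\alpha_{i2})\}$, and $\mathcal M$ is the set of real $N\times N$ matrices with nonpositive off-diagonal entries all of whose leading principal minors are positive. **Exponential stability**: an almost periodic solution $\hat u:\mathbb R\to\mathbb R^N$ of (GNN) is exponentially stable in $\mathcal K^\Sigma$ if $\hat u_t\in\mathcal K^\Sigma$ for all $t\in\mathbb R$ and there are constants $\rho\ge1$, $\mu>0$ such that $\max_i|\hat u^i(t)-u^i(t;\phi)|\le\rho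 e^{-\mu t}\|\hat u_0-\phi\|_\kappa$ for all $t\ge0$ and all $\phi\in\mathcal K^\Sigma$. *)

theory Defs
  imports "HOL-Analysis.Analysis" "Jordan_Normal_Form.Determinant"
begin

(* Neurons are indexed by i, j < N and delay layers by l < M.  Vector functions are families
   nat \<Rightarrow> real \<Rightarrow> real of which only the components below N are meaningful. *)

definition relatively_dense :: "real set \<Rightarrow> bool" where
  "relatively_dense S \<longleftrightarrow> (\<exists>L>0. \<forall>x. \<exists>T\<in>S. x \<le> T \<and> T \<le> x + L)"

definition almost_periodic :: "(real \<Rightarrow> real) \<Rightarrow> bool" where
  "almost_periodic f \<longleftrightarrow> continuous_on UNIV f \<and>
     (\<forall>\<epsilon>>0. relatively_dense {T. \<forall>t. \<bar>f (t + T) - f t\<bar> < \<epsilon>})"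

definition C2_fun :: "(real \<Rightarrow> real) \<Rightarrow> bool" where
  "C2_fun f \<longleftrightarrow> (\<forall>x. f differentiable (at x)) \<and> (\<forall>x. deriv f differentiable (at x)) \<and>
     continuous_on UNIV (deriv (deriv f))"

definition class_A :: "(real \<Rightarrow> real) \<Rightarrow> real \<Rightarrow> bool" where
  "class_A f b \<longleftrightarrow> C2_fun f \<and> (\<forall>x. \<bar>f x\<bar> \<le> b) \<and> f 0 = 0 \<and>
     (\<forall>x. deriv f x > 0) \<and> (\<forall>x. x \<noteq> 0 \<longrightarrow> x * deriv (deriv f) x < 0)"

definition gnn_rhs ::
  "nat \<Rightarrow> nat \<Rightarrow> (nat \<Rightarrow> real \<Rightarrow> real) \<Rightarrow> (nat \<Rightarrow> nat \<Rightarrow> nat \<Rightarrow> real \<Rightarrow> real) \<Rightarrow>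
   (nat \<Rightarrow> nat \<Rightarrow> nat \<Rightarrow> real \<Rightarrow> real) \<Rightarrow> (nat \<Rightarrow> real) \<Rightarrow> (nat \<Rightarrow> real \<Rightarrow> real) \<Rightarrow>
   (nat \<Rightarrow> real \<Rightarrow> real) \<Rightarrow> (nat \<Rightarrow> real \<Rightarrow> real) \<Rightarrow> nat \<Rightarrow> real \<Rightarrow> real" where
  "gnn_rhs N M c a \<kappa> \<sigma> g J u i t =
     - c i t * u i t +
     (\<Sum>l<M. \<Sum>j<N. a i j l t * g j (\<sigma> j * u j (t - \<kappa> i j l t))) + J i t"

definition max_delay :: "nat \<Rightarrow> nat \<Rightarrow> (nat \<Rightarrow> nat \<Rightarrow> nat \<Rightarrow> real) \<Rightarrow> real" where
  "max_delay N M \<kappa>b = Max {\<kappa>b i j l | i j l. i < N \<and> j < N \<and> l < M}"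

(* In the following, X is the right-hand side as a functional of the whole trajectory
   and r is the length of the history interval [-r, 0]. *)

definition entire_solution ::
  "nat \<Rightarrow> ((nat \<Rightarrow> real \<Rightarrow> real) \<Rightarrow> nat \<Rightarrow> real \<Rightarrow> real) \<Rightarrow> (nat \<Rightarrow> real \<Rightarrow> real) \<Rightarrow> bool" where
  "entire_solution N X u \<longleftrightarrow>
     (\<forall>i<N. \<forall>t. (u i has_real_derivative X u i t) (at t))"

(* The derivative at t = 0 is the right-hand one; values of v below -r are irrelevant. *)
definition ivp_solution ::
  "nat \<Rightarrow> ((nat \<Rightarrow> real \<Rightarrow> real) \<Rightarrow> nat \<Rightarrow> real \<Rightarrow> real) \<Rightarrow> real \<Rightarrow>
   (nat \<Rightarrow> real \<Rightarrow> real) \<Rightarrow> (nat \<Rightarrow> real \<Rightarrow> real) \<Rightarrow> bool" where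
  "ivp_solution N X r \<phi> v \<longleftrightarrow>
     (\<forall>i<N. (\<forall>s\<in>{-r..0}. v i s = \<phi> i s) \<and>
            (\<forall>t\<ge>0. (v i has_real_derivative X v i t) (at t within {0..})))"

definition hist_norm :: "nat \<Rightarrow> real \<Rightarrow> (nat \<Rightarrow> real \<Rightarrow> real) \<Rightarrow> real" where
  "hist_norm N r \<phi> = Max ((\<lambda>i. SUP s\<in>{-r..0}. \<bar>\<phi> i s\<bar>) ` {..<N})"

definition segment :: "(nat \<Rightarrow> real \<Rightarrow> real) \<Rightarrow> real \<Rightarrow> nat \<Rightarrow> real \<Rightarrow> real" where
  "segment u t = (\<lambda>i s. u i (t + s))"

(* Elements of C([-r,0]) are represented by functions on the whole line;
   the values outside [-r,0] are unconstrained. *)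
definition basin1 :: "real \<Rightarrow> real \<Rightarrow> (real \<Rightarrow> real) set" where
  "basin1 r \<beta> = {\<psi>. continuous_on {-r..0} \<psi> \<and> (\<forall>s\<in>{-r..0}. \<psi> s \<le> \<beta>)}"

definition basin2 :: "real \<Rightarrow> real \<Rightarrow> (real \<Rightarrow> real) set" where
  "basin2 r \<alpha> = {\<psi>. continuous_on {-r..0} \<psi> \<and> (\<forall>s\<in>{-r..0}. \<psi> s \<ge> \<alpha>)}"

definition basin ::
  "nat \<Rightarrow> real \<Rightarrow> (nat \<Rightarrow> real) \<Rightarrow> (nat \<Rightarrow> real) \<Rightarrow> (nat \<Rightarrow> nat) \<Rightarrow>
   (nat \<Rightarrow> real \<Rightarrow> real) set" where
  "basin N r \<beta> \<alpha> sel =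
     {\<phi>. \<forall>i<N. \<phi> i \<in> (if sel i = 1 then basin1 r (\<beta> i) else basin2 r (\<alpha> i))}"

(* The solution with initial function \<phi> is not picked by a choice operator: it is required
   to exist, and every solution with this initial function has to satisfy the estimate. *)
definition exponentially_stable_in ::
  "nat \<Rightarrow> ((nat \<Rightarrow> real \<Rightarrow> real) \<Rightarrow> nat \<Rightarrow> real \<Rightarrow> real) \<Rightarrow> real \<Rightarrow>
   (nat \<Rightarrow> real \<Rightarrow> real) set \<Rightarrow> (nat \<Rightarrow> real \<Rightarrow> real) \<Rightarrow> bool" where
  "exponentially_stable_in N X r K u \<longleftrightarrow>
     (\<forall>t. segment u t \<in> K) \<and>
     (\<exists>\<rho>\<ge>1. \<exists>\<mu>>0. \<forall>\<phi>\<in>K.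
        (\<exists>v. ivp_solution N X r \<phi> v) \<and>
        (\<forall>v. ivp_solution N X r \<phi> v \<longrightarrow>
           (\<forall>t\<ge>0. Max ((\<lambda>i. \<bar>u i t - v i t\<bar>) ` {..<N})
                   \<le> \<rho> * exp (- \<mu> * t) * hist_norm N r (\<lambda>i s. segment u 0 i s - \<phi> i s))))"

definition stable_ap_solution ::
  "nat \<Rightarrow> ((nat \<Rightarrow> real \<Rightarrow> real) \<Rightarrow> nat \<Rightarrow> real \<Rightarrow> real) \<Rightarrow> real \<Rightarrow>
   (nat \<Rightarrow> real \<Rightarrow> real) set \<Rightarrow> (nat \<Rightarrow> real \<Rightarrow> real) \<Rightarrow> bool" where
  "stable_ap_solution N X r K u \<longleftrightarrow>
     (\<forall>i<N. almost_periodic (u i)) \<and> entire_solution N X u \<and>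
     exponentially_stable_in N X r K u"

definition aux_F ::
  "nat \<Rightarrow> (nat \<Rightarrow> real \<Rightarrow> real) \<Rightarrow> (nat \<Rightarrow> nat \<Rightarrow> nat \<Rightarrow> real \<Rightarrow> real) \<Rightarrow>
   (nat \<Rightarrow> real) \<Rightarrow> (nat \<Rightarrow> real \<Rightarrow> real) \<Rightarrow> nat \<Rightarrow> real \<Rightarrow> real" where
  "aux_F M c a \<sigma> g i z =
     - (SUP t. c i t) * z + (INF t. \<Sum>l<M. a i i l t) * g i (\<sigma> i * z)"

definition coupling_bound ::
  "nat \<Rightarrow> nat \<Rightarrow> (nat \<Rightarrow> nat \<Rightarrow> nat \<Rightarrow> real \<Rightarrow> real) \<Rightarrow> (nat \<Rightarrow> real) \<Rightarrow> nat \<Rightarrow> real" where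
  "coupling_bound N M a B i = (\<Sum>l<M. \<Sum>j\<in>{..<N} - {i}. (SUP t. \<bar>a i j l t\<bar>) * B j)"

definition leading_principal_minor :: "real mat \<Rightarrow> nat \<Rightarrow> real" where
  "leading_principal_minor A k = Determinant.det (Matrix.mat k k (\<lambda>(p, q). A $$ (p, q)))"

definition class_M :: "nat \<Rightarrow> real mat set" where
  "class_M N = {A \<in> carrier_mat N N.
     (\<forall>p<N. \<forall>q<N. p \<noteq> q \<longrightarrow> A $$ (p, q) \<le> 0) \<and>
     (\<forall>k\<in>{1..N}. leading_principal_minor A k > 0)}"

definition C_mat :: "nat \<Rightarrow> (nat \<Rightarrow> real \<Rightarrow> real) \<Rightarrow> real mat" where
  "C_mat N c = mat_diag N (\<lambda>i. INF t. c i t)"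

definition H_mat :: "nat \<Rightarrow> nat \<Rightarrow> (nat \<Rightarrow> nat \<Rightarrow> nat \<Rightarrow> real \<Rightarrow> real) \<Rightarrow> real mat" where
  "H_mat N M a = Matrix.mat N N (\<lambda>(i, j). \<Sum>l<M. SUP t. \<bar>a i j l t\<bar>)"

definition G_mat ::
  "nat \<Rightarrow> (nat \<Rightarrow> real) \<Rightarrow> (nat \<Rightarrow> real \<Rightarrow> real) \<Rightarrow> (nat \<Rightarrow> real) \<Rightarrow> (nat \<Rightarrow> real) \<Rightarrow> real mat" where
  "G_mat N \<sigma> g \<beta> \<alpha> =
     mat_diag N (\<lambda>i. \<sigma> i * max (deriv (g i) (\<sigma> i * \<beta> i)) (deriv (g i) (\<sigma> i * \<alpha> i)))"

end

theory Submission
  imports Defs "HOL-Probability.Discrete_Topology"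
begin

text \<open>
  Fix a basin and replace every argument of an activation function by its projection to the
  basin. There the activation functions have slope at most \<open>\<gamma>\<close>, by the sign of the second
  derivative, so the projected system is globally Lipschitz. The M-matrix condition provides
  weights \<open>\<xi> > 0\<close> for which, in the \<open>\<xi>\<close>-weighted sup norm, the map that solves the decoupled linear
  equations for a given input is a contraction; its fixed point among the bounded functions on
  the line is an entire solution, and its fixed point among the functions with prescribed history
  solves the initial value problem. By the equations for \<open>\<beta>\<close> and \<open>\<alpha>\<close> the vector field points into
  the basin, hence the projection has no effect on these solutions.

  Everything else is the same contraction estimate applied to a difference of solutions: of two
  bounded entire solutions (uniqueness), of a solution and its translate by a common almost period
  of all coefficients (almost periodicity), and, after multiplication by \<open>exp (\<mu> t)\<close>, of the entire
  solution and a solution starting in the basin (exponential stability).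
\<close>

section \<open>Scalar linear equations\<close>

text \<open>Two facts let one contraction serve every purpose. The scalar linear equation has gain
  at most \<open>1 / c0 i\<close> in the sup norm, uniformly in time although \<open>c i\<close>
  varies; hence no interval has to be kept short, and line and half-line are treated alike. And the
  M-matrix condition yields \<open>\<xi> > 0\<close> with \<open>row_sum i < c0 i * \<xi> i\<close>:
  measured with these weights, the coupling is strictly weaker than the damping. The strictness
  leaves room for a factor \<open>\<theta> < 1\<close> and for a rate \<open>\<mu>\<close>, because
  multiplying by \<open>exp (\<mu> * t)\<close> lowers the damping to \<open>c0 i - \<mu>\<close>
  and raises the coupling by at most \<open>exp (\<mu> * r)\<close>. The slope bound
  \<open>\<gamma>\<close> fails near 0, where the activation functions are steepest, so both
  solutions must be known to lie in the region before they are compared. In the definition of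
  stability the second solution is arbitrary, so its invariance has to be proved without the fixed
  point. Almost periodicity meets a further obstacle: translating time also moves the delayed
  argument \<open>t - \<kappa> i j l t\<close>, which is absorbed by a Lipschitz bound on the
  solution.\<close>

lemma continuous_on_UNIV_imp_ex_antiderivative:
  fixes f :: "real \<Rightarrow> real"
  assumes "continuous_on UNIV f"
  shows "\<exists>F. \<forall>x. (F has_real_derivative f x) (at x)"
proof -
  have "\<exists>F. \<forall>x :: real. (-\<infinity>::ereal) < x \<longrightarrow> x < (\<infinity>::ereal) \<longrightarrow> (F has_vector_derivative f x) (at x)"
    by (rule einterval_antiderivative) (use assms in \<open>auto simp: continuous_on_eq_continuous_at\<close>)
  then show ?thesis
    by (auto simp: has_real_derivative_iff_has_vector_derivative)
qed

text \<open>Integrating factor: if \<open>C' = c\<close>, then \<open>exp (C s) * w s\<close> is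
  nonincreasing, and \<open>C t - C t0 \<ge> c0 * (t - t0)\<close>. The maximum with 0 appears
  because the latter estimate can be multiplied only by a nonnegative initial value. Derivatives
  within \<open>{t0..t}\<close> suit solutions on the line and on a half-line.\<close>

lemma linear_comparison_within:
  fixes w w' c :: "real \<Rightarrow> real"
  assumes c: "continuous_on UNIV c" and cc0: "\<And>s. c s \<ge> c0" and "t0 \<le> t"
    and dw: "\<And>s. t0 \<le> s \<Longrightarrow> s \<le> t \<Longrightarrow> (w has_real_derivative w' s) (at s within {t0..t})"
    and le: "\<And>s. t0 \<le> s \<Longrightarrow> s \<le> t \<Longrightarrow> w' s \<le> - c s * w s"
  shows "w t \<le> exp (- c0 * (t - t0)) * max 0 (w t0)"
proof -
  obtain C where C: "\<And>x. (C has_real_derivative c x) (at x)"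
    using continuous_on_UNIV_imp_ex_antiderivative[OF c] by auto
  have mono: "exp (C t) * w t \<le> exp (C t0) * w t0"
  proof (cases "t0 = t")
    case False
    then have "t0 < t" using \<open>t0 \<le> t\<close> by simp
    define h where "h s = exp (C s) * w s" for s
    have dh: "(h has_real_derivative exp (C s) * (c s * w s + w' s)) (at s within {t0..t})"
      if "t0 \<le> s" "s \<le> t" for s
      unfolding h_def
      by (rule derivative_eq_intros DERIV_subset[OF C] dw that | simp add: algebra_simps)+
    have "h t \<le> h t0"
    proof (rule DERIV_nonpos_imp_decreasing_open[OF \<open>t0 \<le> t\<close>])
      show "continuous_on {t0..t} h"
        by (intro DERIV_continuous_on[where D="\<lambda>s. exp (C s) * (c s * w s + w' s)"] dh) auto
      fix s assume s: "t0 < s" "s < t"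
      have "(h has_real_derivative exp (C s) * (c s * w s + w' s)) (at s)"
        using dh[of s] s by (simp add: at_within_Icc_at)
      moreover have "exp (C s) * (c s * w s + w' s) \<le> 0"
        using le[of s] s by (intro mult_nonneg_nonpos) auto
      ultimately show "\<exists>y. (h has_real_derivative y) (at s) \<and> y \<le> 0" by blast
    qed
    then show ?thesis by (simp add: h_def)
  qed simp
  have "C t0 - c0 * t0 \<le> C t - c0 * t"
  proof (rule DERIV_nonneg_imp_nondecreasing[OF \<open>t0 \<le> t\<close>])
    fix s
    have "((\<lambda>x. C x - c0 * x) has_real_derivative c s - c0) (at s)"
      by (auto intro!: derivative_eq_intros C)
    then show "\<exists>y. ((\<lambda>x. C x - c0 * x) has_real_derivative y) (at s) \<and> 0 \<le> y"
      using cc0[of s] by auto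
  qed
  then have e: "exp (C t0 - C t) \<le> exp (- c0 * (t - t0))" by (simp add: algebra_simps)
  have "w t = exp (- C t) * (exp (C t) * w t)" by (simp add: exp_minus field_simps)
  also have "\<dots> \<le> exp (- C t) * (exp (C t0) * w t0)" using mono by simp
  also have "\<dots> = exp (C t0 - C t) * w t0" by (simp add: exp_diff exp_minus field_simps)
  also have "\<dots> \<le> exp (C t0 - C t) * max 0 (w t0)" by (intro mult_left_mono) auto
  also have "\<dots> \<le> exp (- c0 * (t - t0)) * max 0 (w t0)" using e by (intro mult_right_mono) auto
  finally show ?thesis .
qed

lemma linear_comparison_forward:
  fixes w w' c :: "real \<Rightarrow> real"
  assumes c: "continuous_on UNIV c" and cc0: "\<And>s. c s \<ge> c0" and "c0 \<ge> 0" and "t0 \<le> t"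
    and dw: "\<And>s. t0 \<le> s \<Longrightarrow> s \<le> t \<Longrightarrow> (w has_real_derivative w' s) (at s within {t0..})"
    and le: "\<And>s. t0 \<le> s \<Longrightarrow> s \<le> t \<Longrightarrow> w' s \<le> - c s * (w s - K)"
    and "w t0 \<le> K"
  shows "w t \<le> K"
proof -
  have "w t - K \<le> exp (- c0 * (t - t0)) * max 0 (w t0 - K)"
  proof (rule linear_comparison_within[OF c cc0 \<open>t0 \<le> t\<close>])
    fix s assume s: "t0 \<le> s" "s \<le> t"
    show "((\<lambda>s. w s - K) has_real_derivative w' s) (at s within {t0..t})"
      by (auto intro!: derivative_eq_intros DERIV_subset[OF dw] s)
  qed (use le in auto)
  then show ?thesis using \<open>w t0 \<le> K\<close> by simp
qed

text \<open>There is no initial time, so the comparison starts at \<open>t - s\<close> and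
  \<open>s\<close> tends to infinity: boundedness of \<open>w\<close> limits the contribution of the
  start to \<open>exp (- c0 * s) * (W + \<bar>K\<bar>)\<close>, which vanishes.\<close>

lemma linear_comparison_bounded:
  fixes w w' c :: "real \<Rightarrow> real"
  assumes c: "continuous_on UNIV c" and cc0: "\<And>s. c s \<ge> c0" and "c0 > 0"
    and dw: "\<And>s. (w has_real_derivative w' s) (at s)"
    and le: "\<And>s. w' s \<le> - c s * (w s - K)"
    and bd: "\<And>s. \<bar>w s\<bar> \<le> W"
  shows "w t \<le> K"
proof -
  have bnd: "w t - K \<le> exp (- c0 * s) * (W + \<bar>K\<bar>)" if "s \<ge> 0" for s
  proof -
    have "w t - K \<le> exp (- c0 * (t - (t - s))) * max 0 (w (t - s) - K)"
    proof (rule linear_comparison_within[OF c cc0])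
      show "((\<lambda>s. w s - K) has_real_derivative w' x) (at x within {t - s..t})" for x
        by (auto intro!: derivative_eq_intros DERIV_subset[OF dw])
    qed (use le that in auto)
    also have "\<dots> \<le> exp (- c0 * s) * (W + \<bar>K\<bar>)"
      using bd[of "t - s"] by (auto intro!: mult_left_mono)
    finally show ?thesis .
  qed
  have "((\<lambda>s. exp (- c0 * s)) \<longlongrightarrow> 0) at_top"
  proof (rule filterlim_compose[OF exp_at_bot])
    show "filterlim (\<lambda>s. - c0 * s) at_bot at_top"
      using \<open>c0 > 0\<close> by (intro filterlim_tendsto_neg_mult_at_bot[where c="-c0"]) (auto simp: filterlim_ident)
  qed
  then have "((\<lambda>s. exp (- c0 * s) * (W + \<bar>K\<bar>)) \<longlongrightarrow> 0 * (W + \<bar>K\<bar>)) at_top"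
    by (intro tendsto_intros)
  then have "w t - K \<le> 0 * (W + \<bar>K\<bar>)"
    by (rule tendsto_lowerbound) (use bnd in \<open>auto intro!: eventually_at_top_linorderI[of 0]\<close>)
  then show ?thesis by simp
qed

text \<open>The constant \<open>D\<close> is a barrier for both \<open>w\<close> and
  \<open>- w\<close>, because \<open>c s * D \<ge> c0 * D \<ge> \<bar>f s\<bar>\<close>. Applied to
  differences of bounded solutions this is the gain \<open>1 / c0\<close>;
  \<open>linear_forward_abs_le\<close> is the half-line counterpart.\<close>

lemma linear_bounded_abs_le:
  fixes w c :: "real \<Rightarrow> real"
  assumes c: "continuous_on UNIV c" and cc0: "\<And>s. c s \<ge> c0" and "c0 > 0"
    and dw: "\<And>s. (w has_real_derivative - c s * w s + f s) (at s)"
    and bd: "\<And>s. \<bar>w s\<bar> \<le> W"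
    and f: "\<And>s. \<bar>f s\<bar> \<le> c0 * D" and "D \<ge> 0"
  shows "\<bar>w t\<bar> \<le> D"
proof -
  have cD: "c0 * D \<le> c s * D" for s using cc0 \<open>D \<ge> 0\<close> by (simp add: mult_right_mono)
  have "w t \<le> D"
  proof (rule linear_comparison_bounded[OF c cc0 \<open>c0 > 0\<close> dw _ bd])
    fix s show "- c s * w s + f s \<le> - c s * (w s - D)"
      using f[of s] cD[of s] by (simp add: algebra_simps)
  qed
  moreover have "- w t \<le> D"
  proof (rule linear_comparison_bounded[where w="\<lambda>s. - w s", OF c cc0 \<open>c0 > 0\<close>])
    fix s show "((\<lambda>s. - w s) has_real_derivative - (- c s * w s + f s)) (at s)"
      by (rule DERIV_minus[OF dw])
    show "- (- c s * w s + f s) \<le> - c s * (- w s - D)"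
      using f[of s] cD[of s] by (simp add: algebra_simps)
    show "\<bar>- w s\<bar> \<le> W" using bd by simp
  qed
  ultimately show ?thesis by simp
qed

lemma linear_forward_abs_le:
  fixes w c :: "real \<Rightarrow> real"
  assumes c: "continuous_on UNIV c" and cc0: "\<And>s. c s \<ge> c0" and "c0 > 0" and "0 \<le> t"
    and dw: "\<And>s. 0 \<le> s \<Longrightarrow> s \<le> t \<Longrightarrow> (w has_real_derivative - c s * w s + f s) (at s within {0..})"
    and f: "\<And>s. 0 \<le> s \<Longrightarrow> s \<le> t \<Longrightarrow> \<bar>f s\<bar> \<le> c0 * D" and D: "\<bar>w 0\<bar> \<le> D"
  shows "\<bar>w t\<bar> \<le> D"
proof -
  have cD: "c0 * D \<le> c s * D" for s using cc0 D by (simp add: mult_right_mono)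
  note fwd = linear_comparison_forward[OF c cc0 less_imp_le[OF \<open>c0 > 0\<close>] \<open>0 \<le> t\<close>]
  have "w t \<le> D"
  proof (rule fwd[OF dw])
    fix s assume "0 \<le> s" "s \<le> t"
    then show "- c s * w s + f s \<le> - c s * (w s - D)"
      using f[of s] cD[of s] by (simp add: algebra_simps)
  qed (use D in auto)
  moreover have "- w t \<le> D"
  proof (rule fwd[where w="\<lambda>s. - w s"])
    fix s assume s: "0 \<le> s" "s \<le> t"
    show "((\<lambda>s. - w s) has_real_derivative - (- c s * w s + f s)) (at s within {0..})"
      by (rule DERIV_minus[OF dw]) (use s in auto)
    show "- (- c s * w s + f s) \<le> - c s * (- w s - D)"
      using s f[of s] cD[of s] by (simp add: algebra_simps)
  qed (use D in auto)
  ultimately show ?thesis by simp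
qed

text \<open>Variation of constants started at minus infinity:
  \<open>exp (- C t) * (P t - p0)\<close>, where \<open>P\<close> is an antiderivative of
  \<open>exp (C x) * f x\<close> and \<open>p0\<close> its limit at minus infinity. As
  \<open>c x / c0 \<ge> 1\<close>, the function \<open>F / c0 * exp (C x)\<close> grows at least as
  fast as \<open>P\<close> varies; this gives both the limit and the bound
  \<open>F / c0\<close>.\<close>

lemma linear_bounded_solution_exists:
  fixes c f :: "real \<Rightarrow> real"
  assumes c: "continuous_on UNIV c" and cc0: "\<And>s. c s \<ge> c0" and "c0 > 0"
    and f: "continuous_on UNIV f" and F: "\<And>s. \<bar>f s\<bar> \<le> F"
  shows "\<exists>w. \<forall>t. (w has_real_derivative - c t * w t + f t) (at t) \<and> \<bar>w t\<bar> \<le> F / c0"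
proof -
  obtain C where C: "\<And>x. (C has_real_derivative c x) (at x)"
    using continuous_on_UNIV_imp_ex_antiderivative[OF c] by auto
  have cC: "continuous_on UNIV C" by (rule DERIV_continuous_on[OF C])
  obtain P where P: "\<And>x. (P has_real_derivative exp (C x) * f x) (at x)"
    using continuous_on_UNIV_imp_ex_antiderivative[OF continuous_on_mult[OF continuous_on_exp[OF cC] f]] by auto
  have "F \<ge> 0" using F[of 0] by linarith
  have dE: "((\<lambda>x. F / c0 * exp (C x)) has_real_derivative F / c0 * (c x * exp (C x))) (at x)" for x
    using \<open>c0 > 0\<close> by (auto intro!: derivative_eq_intros C)
  have key: "\<bar>exp (C x) * f x\<bar> \<le> F / c0 * (c x * exp (C x))" for x
  proof -
    have "\<bar>exp (C x) * f x\<bar> = exp (C x) * \<bar>f x\<bar>" by (simp add: abs_mult)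
    also have "\<dots> \<le> exp (C x) * (F * (c x / c0))"
    proof (intro mult_left_mono order_trans[OF F])
      have "c x / c0 \<ge> 1" using cc0[of x] \<open>c0 > 0\<close> by (simp add: le_divide_eq)
      then show "F \<le> F * (c x / c0)" using \<open>F \<ge> 0\<close> by (metis mult.right_neutral mult_left_mono)
    qed auto
    finally show ?thesis by (simp add: field_simps)
  qed
  have PP: "\<bar>P t - P s\<bar> \<le> F / c0 * exp (C t) - F / c0 * exp (C s)" if "s \<le> t" for s t
  proof -
    have "P s - F / c0 * exp (C s) \<ge> P t - F / c0 * exp (C t)"
    proof (rule DERIV_nonpos_imp_nonincreasing[OF that])
      fix x show "\<exists>y. ((\<lambda>x. P x - F / c0 * exp (C x)) has_real_derivative y) (at x) \<and> y \<le> 0"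
        using DERIV_diff[OF P dE, of x] key[of x] by (intro exI conjI) auto
    qed
    moreover have "P s + F / c0 * exp (C s) \<le> P t + F / c0 * exp (C t)"
    proof (rule DERIV_nonneg_imp_nondecreasing[OF that])
      fix x show "\<exists>y. ((\<lambda>x. P x + F / c0 * exp (C x)) has_real_derivative y) (at x) \<and> y \<ge> 0"
        using DERIV_add[OF P dE, of x] key[of x] by (intro exI conjI) auto
    qed
    ultimately show ?thesis by linarith
  qed
  have Fc: "F / c0 \<ge> 0" using \<open>F \<ge> 0\<close> \<open>c0 > 0\<close> by simp
  \<comment> \<open>\<open>Q\<close> is nonincreasing and nonnegative, hence Cauchy, and its
    increments control those of \<open>p\<close>. A limit of \<open>P\<close> along the negative
    integers is enough to define \<open>p0\<close>.\<close>
  define Q where "Q n = F / c0 * exp (C (- real n))" for n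
  define p where "p n = P (- real n)" for n
  have Q0: "Q n \<ge> 0" for n unfolding Q_def by (intro mult_nonneg_nonneg Fc) simp
  have Qdec: "decseq Q"
  proof (rule decseq_SucI)
    fix n
    show "Q (Suc n) \<le> Q n"
      using PP[of "- real (Suc n)" "- real n"] unfolding Q_def by linarith
  qed
  then have "convergent Q" using decseq_convergent[of Q 0] Q0 by (metis convergentI)
  then have "Cauchy Q" by (rule convergent_Cauchy)
  have "Cauchy p"
  proof (rule metric_CauchyI)
    fix e :: real assume "e > 0"
    then obtain M where M: "\<And>m n. m \<ge> M \<Longrightarrow> n \<ge> M \<Longrightarrow> dist (Q m) (Q n) < e"
      using metric_CauchyD[OF \<open>Cauchy Q\<close>] by blast
    have "dist (p m) (p n) \<le> dist (Q m) (Q n)" for m n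
      using PP[of "- real m" "- real n"] PP[of "- real n" "- real m"]
      unfolding p_def Q_def dist_real_def by linarith
    then show "\<exists>M. \<forall>m\<ge>M. \<forall>n\<ge>M. dist (p m) (p n) < e" using M by (meson le_less_trans)
  qed
  then obtain p0 where p0: "p \<longlonglongrightarrow> p0" using Cauchy_convergent convergent_def by blast
  have Pp0: "\<bar>P t - p0\<bar> \<le> F / c0 * exp (C t)" for t
  proof (rule tendsto_upperbound)
    show "(\<lambda>n. \<bar>P t - p n\<bar>) \<longlonglongrightarrow> \<bar>P t - p0\<bar>" by (intro tendsto_intros p0)
    show "\<forall>\<^sub>F n in sequentially. \<bar>P t - p n\<bar> \<le> F / c0 * exp (C t)"
    proof (rule eventually_sequentiallyI)
      fix n assume "nat \<lceil>- t\<rceil> \<le> n"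
      then have "- real n \<le> t" by linarith
      then show "\<bar>P t - p n\<bar> \<le> F / c0 * exp (C t)"
        using PP[of "- real n" t] Q0[of n] unfolding p_def Q_def by linarith
    qed
  qed simp
  define w where "w t = exp (- C t) * (P t - p0)" for t
  have "(w has_real_derivative - c t * w t + f t) (at t)" for t
  proof -
    have "(w has_real_derivative exp (- C t) * (- c t) * (P t - p0) + exp (- C t) * (exp (C t) * f t)) (at t)"
      unfolding w_def by (auto intro!: derivative_eq_intros C P)
    also have "exp (- C t) * (- c t) * (P t - p0) + exp (- C t) * (exp (C t) * f t) = - c t * w t + f t"
      by (simp add: w_def exp_minus)
    finally show ?thesis .
  qed
  moreover have "\<bar>w t\<bar> \<le> F / c0" for t
  proof -
    have "\<bar>w t\<bar> = exp (- C t) * \<bar>P t - p0\<bar>" by (simp add: w_def abs_mult)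
    also have "\<dots> \<le> exp (- C t) * (F / c0 * exp (C t))" by (intro mult_left_mono Pp0) auto
    also have "\<dots> = F / c0" by (simp add: exp_minus)
    finally show ?thesis .
  qed
  ultimately show ?thesis by blast
qed

lemma linear_ivp_solution_exists:
  fixes c f \<phi> :: "real \<Rightarrow> real"
  assumes c: "continuous_on UNIV c" and f: "continuous_on UNIV f"
    and \<phi>: "continuous_on {..0} \<phi>"
  shows "\<exists>w. continuous_on UNIV w \<and> (\<forall>t\<le>0. w t = \<phi> t) \<and>
           (\<forall>t\<ge>0. (w has_real_derivative - c t * w t + f t) (at t within {0..}))"
proof -
  obtain C where C: "\<And>x. (C has_real_derivative c x) (at x)"
    using continuous_on_UNIV_imp_ex_antiderivative[OF c] by auto
  have cC: "continuous_on UNIV C" by (rule DERIV_continuous_on[OF C])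
  obtain P where P: "\<And>x. (P has_real_derivative exp (C x) * f x) (at x)"
    using continuous_on_UNIV_imp_ex_antiderivative[OF continuous_on_mult[OF continuous_on_exp[OF cC] f]] by auto
  have cP: "continuous_on UNIV P" by (rule DERIV_continuous_on[OF P])
  define v where "v t = exp (- C t) * (P t - P 0 + exp (C 0) * \<phi> 0)" for t
  define w where "w t = (if t \<le> 0 then \<phi> t else v t)" for t
  have v0: "v 0 = \<phi> 0" by (simp add: v_def exp_minus)
  have wv: "w t = v t" if "t \<ge> 0" for t using that v0 by (auto simp: w_def)
  have dv: "(v has_real_derivative - c t * v t + f t) (at t within S)" for t S
  proof -
    have "(v has_real_derivative exp (- C t) * (- c t) * (P t - P 0 + exp (C 0) * \<phi> 0) + exp (- C t) * (exp (C t) * f t)) (at t within S)"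
      unfolding v_def by (auto intro!: derivative_eq_intros DERIV_subset[OF C] DERIV_subset[OF P])
    also have "exp (- C t) * (- c t) * (P t - P 0 + exp (C 0) * \<phi> 0) + exp (- C t) * (exp (C t) * f t) = - c t * v t + f t"
      by (simp add: v_def exp_minus)
    finally show ?thesis .
  qed
  have dw: "(w has_real_derivative - c t * w t + f t) (at t within {0..})" if "t \<ge> 0" for t
    unfolding wv[OF that]
    by (rule has_field_derivative_transform_within[OF dv, where d=1]) (use that wv in auto)
  have "continuous_on ({..0} \<union> {0..}) (\<lambda>t. if t \<le> 0 then \<phi> t else v t)"
    by (rule continuous_on_If) (use \<phi> v0 in \<open>auto intro!: DERIV_continuous_on[OF dv]\<close>)
  moreover have "{..0} \<union> {0..} = (UNIV :: real set)" by auto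
  ultimately have "continuous_on UNIV w"
    by (simp add: w_def[abs_def])
  with dw show ?thesis by (intro exI[of _ w]) (auto simp: w_def)
qed

section \<open>Almost periodic functions\<close>

lemma almost_periodicD:
  assumes "almost_periodic f" "\<epsilon> > 0"
  obtains L where "L > 0" "\<And>x. \<exists>T. x \<le> T \<and> T \<le> x + L \<and> (\<forall>t. \<bar>f (t + T) - f t\<bar> < \<epsilon>)"
proof -
  have "relatively_dense {T. \<forall>t. \<bar>f (t + T) - f t\<bar> < \<epsilon>}"
    using assms unfolding almost_periodic_def by simp
  then obtain L where "L > 0" "\<And>x. \<exists>T\<in>{T. \<forall>t. \<bar>f (t + T) - f t\<bar> < \<epsilon>}. x \<le> T \<and> T \<le> x + L"
    unfolding relatively_dense_def by auto
  then show thesis by (intro that[of L]) auto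
qed

lemma almost_periodic_bounded:
  assumes "almost_periodic f"
  shows "\<exists>K. \<forall>t. \<bar>f t\<bar> \<le> K"
proof -
  have cont: "continuous_on UNIV f" using assms by (simp add: almost_periodic_def)
  obtain L where L: "L > 0" "\<And>x. \<exists>T. x \<le> T \<and> T \<le> x + L \<and> (\<forall>t. \<bar>f (t + T) - f t\<bar> < 1)"
    using almost_periodicD[OF assms, of 1] by auto
  have "bounded (f ` {0..L})"
    by (intro compact_imp_bounded compact_continuous_image continuous_on_subset[OF cont]) auto
  then obtain K where "\<forall>y\<in>f ` {0..L}. norm y \<le> K"
    unfolding bounded_iff by blast
  then have K: "\<bar>f x\<bar> \<le> K" if "0 \<le> x" "x \<le> L" for x
    using that by simp
  have "\<bar>f t\<bar> \<le> K + 1" for t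
  proof -
    obtain T where "- t \<le> T" "T \<le> - t + L" "\<bar>f (t + T) - f t\<bar> < 1" using L(2)[of "-t"] by blast
    with K[of "t + T"] show ?thesis by linarith
  qed
  then show ?thesis by blast
qed

lemma almost_periodic_uniformly_continuous:
  assumes "almost_periodic f" "\<epsilon> > 0"
  obtains \<delta> where "\<delta> > 0" "\<And>s t. \<bar>s - t\<bar> < \<delta> \<Longrightarrow> \<bar>f s - f t\<bar> < \<epsilon>"
proof -
  have cont: "continuous_on UNIV f" using assms by (simp add: almost_periodic_def)
  obtain L where L: "L > 0" "\<And>x. \<exists>T. x \<le> T \<and> T \<le> x + L \<and> (\<forall>t. \<bar>f (t + T) - f t\<bar> < \<epsilon> / 3)"
    using almost_periodicD[OF assms(1), of "\<epsilon> / 3"] assms(2) by auto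
  \<comment> \<open>An almost period moves \<open>t\<close> into \<open>[0, L]\<close>; the margin 1
    keeps the neighbouring point \<open>s + T\<close> in the interval too.\<close>
  have "uniformly_continuous_on {-1..L+1} f"
    by (intro compact_uniformly_continuous continuous_on_subset[OF cont]) auto
  then obtain d where d: "d > 0" "\<And>x y. x \<in> {-1..L+1} \<Longrightarrow> y \<in> {-1..L+1} \<Longrightarrow> \<bar>x - y\<bar> < d \<Longrightarrow> \<bar>f x - f y\<bar> < \<epsilon> / 3"
  proof -
    have "\<epsilon> / 3 > 0" using assms(2) by simp
    from \<open>uniformly_continuous_on {-1..L+1} f\<close>[unfolded uniformly_continuous_on_def, rule_format, OF this]
    obtain d where d: "d > 0" "\<forall>x\<in>{-1..L+1}. \<forall>x'\<in>{-1..L+1}. dist x' x < d \<longrightarrow> dist (f x') (f x) < \<epsilon> / 3"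
      by (elim exE conjE)
    show thesis
      by (rule that[OF d(1)]) (use d(2) in \<open>simp only: dist_real_def\<close>)
  qed
  show thesis
  proof
    show "min d 1 > 0" using d(1) by simp
    fix s t :: real assume st: "\<bar>s - t\<bar> < min d 1"
    obtain T where T: "- t \<le> T" "T \<le> - t + L" "\<And>x. \<bar>f (x + T) - f x\<bar> < \<epsilon> / 3"
      using L(2)[of "-t"] by blast
    have "\<bar>f (s + T) - f (t + T)\<bar> < \<epsilon> / 3"
      by (rule d(2)) (use st T in auto)
    with T(3)[of s] T(3)[of t] show "\<bar>f s - f t\<bar> < \<epsilon>" by linarith
  qed
qed

text \<open>The translates of an almost periodic function are totally bounded in the sup norm.\<close>

lemma almost_periodic_translates_finite:
  assumes "almost_periodic f" "\<epsilon> > 0"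
  obtains k :: "real \<Rightarrow> int" where "finite (range k)"
    "\<And>s s' t. k s = k s' \<Longrightarrow> \<bar>f (t + s) - f (t + s')\<bar> < \<epsilon>"
proof -
  have e3: "\<epsilon> / 3 > 0" using assms(2) by simp
  obtain L where L: "L > 0" "\<And>x. \<exists>T. x \<le> T \<and> T \<le> x + L \<and> (\<forall>t. \<bar>f (t + T) - f t\<bar> < \<epsilon> / 3)"
    using almost_periodicD[OF assms(1) e3] by blast
  obtain d where d: "d > 0" "\<And>s t. \<bar>s - t\<bar> < d \<Longrightarrow> \<bar>f s - f t\<bar> < \<epsilon> / 3"
    using almost_periodic_uniformly_continuous[OF assms(1) e3] by blast
  have "\<forall>s. \<exists>T. s - L \<le> T \<and> T \<le> s \<and> (\<forall>t. \<bar>f (t + T) - f t\<bar> < \<epsilon> / 3)"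
    using L(2)[of "s - L" for s] by simp
  from choice[OF this] obtain \<tau> where
    \<tau>: "\<And>s. s - L \<le> \<tau> s" "\<And>s. \<tau> s \<le> s" "\<And>s t. \<bar>f (t + \<tau> s) - f t\<bar> < \<epsilon> / 3"
    by blast
  \<comment> \<open>Since \<open>\<tau> s\<close> is an almost period, translation by
    \<open>s\<close> is close to translation by the remainder \<open>s - \<tau> s\<close>, which
    lies in \<open>[0, L]\<close>. \<open>k\<close> sorts the remainders into finitely many bins of
    width \<open>d\<close>, the modulus of continuity for \<open>\<epsilon> / 3\<close>.\<close>
  define k where "k s = \<lfloor>(s - \<tau> s) / d\<rfloor>" for s
  show thesis
  proof
    have "k s \<in> {0..\<lfloor>L / d\<rfloor>}" for s
      unfolding k_def atLeastAtMost_iff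
      by (rule conjI) (use \<tau>(1,2)[of s] d(1) in \<open>auto intro!: floor_mono divide_right_mono\<close>)
    then have "range k \<subseteq> {0..\<lfloor>L / d\<rfloor>}" by auto
    then show "finite (range k)" by (rule finite_subset) simp
    fix s s' t assume eq: "k s = k s'"
    have "\<bar>(s - \<tau> s) / d - (s' - \<tau> s') / d\<bar> < 1" using eq unfolding k_def by linarith
    then have "\<bar>((s - \<tau> s) - (s' - \<tau> s')) / d\<bar> < 1" by (simp add: diff_divide_distrib)
    then have "\<bar>(t + s - \<tau> s) - (t + s' - \<tau> s')\<bar> < d"
      using d(1) by (simp add: abs_divide algebra_simps)
    then have "\<bar>f (t + s - \<tau> s) - f (t + s' - \<tau> s')\<bar> < \<epsilon> / 3" by (rule d(2))
    moreover have "\<bar>f (t + s) - f (t + s - \<tau> s)\<bar> < \<epsilon> / 3" "\<bar>f (t + s') - f (t + s' - \<tau> s')\<bar> < \<epsilon> / 3"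
      using \<tau>(3)[where s=s and t="t + s - \<tau> s"] \<tau>(3)[where s=s' and t="t + s' - \<tau> s'"]
      by simp_all
    ultimately show "\<bar>f (t + s) - f (t + s')\<bar> < \<epsilon>" by linarith
  qed
qed

text \<open>Finitely many translates represent all translates up to \<open>\<epsilon>\<close>, simultaneously for all
  functions of the family; \<open>s\<close> minus the representative of \<open>s\<close> is then a common almost period.\<close>

lemma almost_periodic_common_periods:
  assumes "finite I" and ap: "\<And>i. i \<in> I \<Longrightarrow> almost_periodic (f i)" and "\<epsilon> > 0"
  shows "relatively_dense {T. \<forall>i\<in>I. \<forall>t. \<bar>f i (t + T) - f i t\<bar> < \<epsilon>}"
proof -
  have "\<exists>k :: real \<Rightarrow> int. finite (range k) \<and> (\<forall>s s' t. k s = k s' \<longrightarrow> \<bar>f i (t + s) - f i (t + s')\<bar> < \<epsilon>)"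
    if "i \<in> I" for i
    by (rule almost_periodic_translates_finite[OF ap[OF that] \<open>\<epsilon> > 0\<close>]) blast
  then have "\<forall>i\<in>I. \<exists>k :: real \<Rightarrow> int. finite (range k) \<and> (\<forall>s s' t. k s = k s' \<longrightarrow> \<bar>f i (t + s) - f i (t + s')\<bar> < \<epsilon>)"
    by blast
  from bchoice[OF this] obtain k :: "_ \<Rightarrow> real \<Rightarrow> int" where k: "\<And>i. i \<in> I \<Longrightarrow> finite (range (k i))"
    "\<And>i s s' t. i \<in> I \<Longrightarrow> k i s = k i s' \<Longrightarrow> \<bar>f i (t + s) - f i (t + s')\<bar> < \<epsilon>"
    by blast
  define K where "K s = restrict (\<lambda>i. k i s) I" for s
  have "range K \<subseteq> PiE I (\<lambda>i. range (k i))" by (auto simp: K_def)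
  then have finK: "finite (range K)"
    by (rule finite_subset) (intro finite_PiE \<open>finite I\<close> k(1))
  define rep where "rep s = inv_into UNIV K (K s)" for s
  have "finite (range rep)"
    unfolding rep_def using finite_imageI[OF finK, of "inv_into UNIV K"] by (simp add: image_image)
  then have "bounded (range rep)" by (rule finite_imp_bounded)
  then obtain R where R: "\<And>s. \<bar>rep s\<bar> \<le> R"
    unfolding bounded_iff by auto
  have "R \<ge> 0" using R[of 0] by linarith
  have rep: "\<bar>f i (t + (s - rep s)) - f i t\<bar> < \<epsilon>" if "i \<in> I" for i s t
  proof -
    have "K (rep s) = K s" unfolding rep_def by (rule f_inv_into_f) simp
    then have "k i s = k i (rep s)" using that unfolding K_def by (metis restrict_apply')
    from k(2)[OF that this, of "t - rep s"] show ?thesis by (simp add: algebra_simps)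
  qed
  \<comment> \<open>For \<open>s = x + R\<close> the almost period \<open>s - rep s\<close> lies in
    \<open>[x, x + 2 * R]\<close>, as \<open>\<bar>rep s\<bar> \<le> R\<close>; the extra 1 makes
    the window length positive when \<open>R = 0\<close>.\<close>
  show ?thesis unfolding relatively_dense_def
  proof (intro exI[of _ "2 * R + 1"] conjI allI)
    fix x
    show "\<exists>T\<in>{T. \<forall>i\<in>I. \<forall>t. \<bar>f i (t + T) - f i t\<bar> < \<epsilon>}. x \<le> T \<and> T \<le> x + (2 * R + 1)"
      using rep R[of "x + R"] by (intro bexI[of _ "(x + R) - rep (x + R)"]) auto
  qed (use \<open>R \<ge> 0\<close> in simp)
qed

lemma relatively_dense_superset:
  "relatively_dense S \<Longrightarrow> S \<subseteq> S' \<Longrightarrow> relatively_dense S'"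
  unfolding relatively_dense_def by (meson subsetD)

section \<open>M-matrices\<close>

text \<open>Induction on the size. Let \<open>x\<close> solve the leading block against minus the
  last column; then \<open>(x, 1)\<close> gives 0 in the first rows and the Schur complement
  \<open>d > 0\<close> in the last. Adding a small multiple of the vector from the induction
  hypothesis makes the first rows positive and keeps the last one positive. The off-diagonal signs
  enter through \<open>x \<ge> 0\<close>.\<close>

lemma leading_minors_pos_imp_semipositive:
  fixes A :: "real mat"
  assumes "A \<in> carrier_mat n n"
    and "\<And>p q. p < n \<Longrightarrow> q < n \<Longrightarrow> p \<noteq> q \<Longrightarrow> A $$ (p, q) \<le> 0"
    and "\<And>k. 1 \<le> k \<Longrightarrow> k \<le> n \<Longrightarrow> leading_principal_minor A k > 0"
  shows "\<exists>\<xi>. (\<forall>i<n. \<xi> i > (0::real)) \<and> (\<forall>i<n. (\<Sum>j<n. A $$ (i, j) * \<xi> j) > 0)"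
  using assms
proof (induction n arbitrary: A)
  case (Suc n)
  define A1 where "A1 = Matrix.mat n n (\<lambda>(p, q). A $$ (p, q))"
  have A1: "A1 \<in> carrier_mat n n" by (simp add: A1_def)
  have A1_entry: "A1 $$ (p, q) = A $$ (p, q)" if "p < n" "q < n" for p q
    using that by (simp add: A1_def)
  have minors: "leading_principal_minor A1 k = leading_principal_minor A k" if "k \<le> n" for k
    unfolding leading_principal_minor_def
    by (rule arg_cong[where f=Determinant.det], rule eq_matI) (use that in \<open>auto simp: A1_def\<close>)
  obtain \<xi> where \<xi>: "\<And>i. i < n \<Longrightarrow> \<xi> i > 0" "\<And>i. i < n \<Longrightarrow> (\<Sum>j<n. A $$ (i, j) * \<xi> j) > 0"
  proof -
    have "\<exists>\<xi>. (\<forall>i<n. \<xi> i > (0::real)) \<and> (\<forall>i<n. (\<Sum>j<n. A1 $$ (i, j) * \<xi> j) > 0)"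
      by (rule Suc.IH[OF A1]) (use Suc.prems minors in \<open>auto simp: A1_entry\<close>)
    then show thesis using that by (auto simp: A1_entry)
  qed
  have detA1: "Determinant.det A1 > 0"
  proof (cases "n = 0")
    case False
    then show ?thesis using Suc.prems(3)[of n] by (simp add: leading_principal_minor_def A1_def)
  qed (use A1 in \<open>auto simp: det_dim_zero\<close>)
  obtain x where x: "\<And>i. i < n \<Longrightarrow> (\<Sum>j<n. A $$ (i, j) * x j) = - A $$ (i, n)"
  proof -
    obtain Bm where B: "Bm \<in> carrier_mat n n" "A1 * Bm = 1\<^sub>m n"
      using det_non_zero_imp_unit[OF A1, of undefined] detA1
      by (auto simp: Units_def ring_mat_def)
    define b where "b = Matrix.vec n (\<lambda>i. - A $$ (i, n))"
    define y where "y = Bm *\<^sub>v b"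
    have b: "b \<in> carrier_vec n" by (simp add: b_def)
    have y: "y \<in> carrier_vec n" using B b by (simp add: y_def)
    have "A1 *\<^sub>v y = (A1 * Bm) *\<^sub>v b"
      unfolding y_def using assoc_mult_mat_vec[OF A1 B(1) b] by simp
    then have Ay: "A1 *\<^sub>v y = b" using B b by simp
    have "(\<Sum>j<n. A $$ (i, j) * vec_index y j) = - A $$ (i, n)" if "i < n" for i
    proof -
      have "vec_index (A1 *\<^sub>v y) i = (\<Sum>j<n. A1 $$ (i, j) * vec_index y j)"
        using A1 y that by (auto simp: scalar_prod_def lessThan_atLeast0 intro!: sum.cong)
      then show ?thesis using Ay that by (simp add: b_def A1_entry)
    qed
    then show thesis using that by blast
  qed
  txt \<open>\<open>x \<ge> 0\<close>: otherwise look at the row in which \<open>x / \<xi>\<close> attains its negative minimum.\<close>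
  have xpos: "x i \<ge> 0" if "i < n" for i
  proof (rule ccontr)
    assume "\<not> x i \<ge> 0"
    define m where "m = Min ((\<lambda>i. x i / \<xi> i) ` {..<n})"
    have "m \<in> (\<lambda>i. x i / \<xi> i) ` {..<n}" unfolding m_def using that by (intro Min_in) auto
    then obtain k where k: "k < n" "x k / \<xi> k = m" by auto
    have mle: "m * \<xi> j \<le> x j" if "j < n" for j
    proof -
      have "m \<le> x j / \<xi> j" unfolding m_def using that by (intro Min_le) auto
      then show ?thesis using \<xi>(1)[OF that] by (simp add: field_simps)
    qed
    have "m \<le> x i / \<xi> i" unfolding m_def using that by (intro Min_le) auto
    also have "\<dots> < 0" using \<open>\<not> x i \<ge> 0\<close> \<xi>(1)[OF that] by (simp add: divide_less_0_iff)
    finally have "m < 0" .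
    have "0 \<le> - A $$ (k, n)" using Suc.prems(2)[of k n] k by simp
    also have "\<dots> = (\<Sum>j<n. A $$ (k, j) * x j)" using x[OF k(1)] by simp
    also have "\<dots> \<le> (\<Sum>j<n. A $$ (k, j) * (m * \<xi> j))"
    proof (rule sum_mono)
      fix j assume "j \<in> {..<n}"
      then have j: "j < n" by simp
      show "A $$ (k, j) * x j \<le> A $$ (k, j) * (m * \<xi> j)"
      proof (cases "j = k")
        case True
        then have "x j = m * \<xi> j" using k \<xi>(1)[OF j] by auto
        then show ?thesis by simp
      next
        case False
        then show ?thesis using Suc.prems(2)[of k j] k j mle[OF j] by (intro mult_left_mono_neg) auto
      qed
    qed
    also have "\<dots> = m * (\<Sum>j<n. A $$ (k, j) * \<xi> j)" by (simp add: sum_distrib_left algebra_simps)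
    also have "\<dots> < 0" using \<open>m < 0\<close> \<xi>(2)[OF k(1)] by (simp add: mult_neg_pos)
    finally show False by simp
  qed
  define d where "d = A $$ (n, n) + (\<Sum>j<n. A $$ (n, j) * x j)"
  txt \<open>\<open>d\<close> is the Schur complement, the quotient of the last two leading minors.\<close>
  have detA: "Determinant.det A = Determinant.det A1 * d"
  proof -
    \<comment> \<open>Multiplication by the unit triangular \<open>X\<close> adds to the last column
      the combination of the others with coefficients \<open>x\<close>. By the choice of
      \<open>x\<close> only \<open>d\<close> survives there, so \<open>Y\<close> is block
      triangular.\<close>
    define X where "X = four_block_mat (1\<^sub>m n) (Matrix.mat n 1 (\<lambda>(i, _). x i)) (0\<^sub>m 1 n) (1\<^sub>m 1)"
    define Y where "Y = four_block_mat A1 (0\<^sub>m n 1) (Matrix.mat 1 n (\<lambda>(_, j). A $$ (n, j))) (Matrix.mat 1 1 (\<lambda>_. d))"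
    have X: "X \<in> carrier_mat (Suc n) (Suc n)" and Y: "Y \<in> carrier_mat (Suc n) (Suc n)"
      using A1 unfolding X_def Y_def by auto
    have "A * X = Y"
    proof (rule eq_matI)
      fix i j assume "i < dim_row Y" "j < dim_col Y"
      then have ij: "i < Suc n" "j < Suc n" using Y by auto
      have "(A * X) $$ (i, j) = (\<Sum>k<Suc n. A $$ (i, k) * X $$ (k, j))"
        using Suc.prems(1) X ij by (auto simp: scalar_prod_def lessThan_atLeast0 intro!: sum.cong)
      also have "\<dots> = (\<Sum>k<n. A $$ (i, k) * X $$ (k, j)) + A $$ (i, n) * X $$ (n, j)" by simp
      also have "\<dots> = Y $$ (i, j)"
      proof (cases "j = n")
        case True
        have "(\<Sum>k<n. A $$ (i, k) * X $$ (k, j)) = (\<Sum>k<n. A $$ (i, k) * x k)"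
          unfolding X_def using True by (intro sum.cong) auto
        moreover have "X $$ (n, j) = 1" unfolding X_def using True by auto
        ultimately show ?thesis
          using True ij A1 x[of i] unfolding Y_def d_def by (cases "i = n") auto
      next
        case False
        then have j: "j < n" using ij by simp
        have "(\<Sum>k<n. A $$ (i, k) * X $$ (k, j)) = (\<Sum>k<n. A $$ (i, k) * (if k = j then 1 else 0))"
          unfolding X_def using j by (intro sum.cong) auto
        also have "\<dots> = A $$ (i, j)" using j by (simp add: if_distrib sum.delta cong: if_cong)
        moreover have "X $$ (n, j) = 0" unfolding X_def using j by auto
        ultimately show ?thesis
          using j ij A1 unfolding Y_def by (cases "i = n") (auto simp: A1_entry)
      qed
      finally show "(A * X) $$ (i, j) = Y $$ (i, j)" .
    qed (use Suc.prems(1) X Y in auto)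
    moreover have "Determinant.det X = 1"
      unfolding X_def by (subst det_four_block_mat_lower_left_zero[where n=n and m=1]) auto
    moreover have "Determinant.det Y = Determinant.det A1 * d"
      unfolding Y_def
      by (subst det_four_block_mat_upper_right_zero[where n=n and m=1]) (use A1 in \<open>auto simp: det_single\<close>)
    ultimately show ?thesis using det_mult[OF Suc.prems(1) X] by simp
  qed
  have "Matrix.mat (Suc n) (Suc n) (\<lambda>(p, q). A $$ (p, q)) = A"
    by (rule eq_matI) (use Suc.prems(1) in auto)
  then have "Determinant.det A > 0"
    using Suc.prems(3)[of "Suc n"] by (simp add: leading_principal_minor_def)
  then have "d > 0" using detA detA1 by (simp add: zero_less_mult_iff)
  define S where "S = (\<Sum>j<n. A $$ (n, j) * \<xi> j)"
  obtain \<eta> where \<eta>: "\<eta> > 0" "d + \<eta> * S > 0"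
  proof -
    define e where "e = d / (\<bar>S\<bar> + 1)"
    have "e > 0" using \<open>d > 0\<close> by (simp add: e_def)
    have "e * (\<bar>S\<bar> + 1) = d" by (simp add: e_def)
    then have "e * \<bar>S\<bar> < d" using \<open>e > 0\<close> by (simp add: algebra_simps)
    moreover have "- (e * S) \<le> e * \<bar>S\<bar>"
      using \<open>e > 0\<close> by (metis abs_ge_minus_self abs_mult abs_of_pos)
    ultimately show thesis using \<open>e > 0\<close> by (intro that[of e]) linarith+
  qed
  define \<zeta> where "\<zeta> i = (if i < n then x i + \<eta> * \<xi> i else 1)" for i
  have row: "(\<Sum>j<Suc n. A $$ (i, j) * \<zeta> j) =
      (\<Sum>j<n. A $$ (i, j) * x j) + \<eta> * (\<Sum>j<n. A $$ (i, j) * \<xi> j) + A $$ (i, n)" for i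
    by (simp add: \<zeta>_def sum.distrib sum_distrib_left algebra_simps)
  show ?case
  proof (intro exI[of _ \<zeta>] conjI allI impI)
    fix i assume i: "i < Suc n"
    show "\<zeta> i > 0" using xpos[of i] \<xi>(1)[of i] \<eta>(1)
      by (auto simp: \<zeta>_def intro!: add_nonneg_pos)
    show "(\<Sum>j<Suc n. A $$ (i, j) * \<zeta> j) > 0"
    proof (cases "i < n")
      case True
      then show ?thesis unfolding row using x \<xi>(2) \<eta>(1) by simp
    next
      case False
      then have "i = n" using i by simp
      then show ?thesis unfolding row using \<eta>(2) by (simp add: d_def S_def algebra_simps)
    qed
  qed
qed simp

section \<open>Networks with a clamped nonlinearity\<close>

text \<open>The fixed point is sought among functions of index and time jointly. A preimage is a
  union of open slices, one per index, so continuity in time suffices.\<close>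

lemma continuous_on_discrete_Times:
  fixes h :: "'a discrete \<Rightarrow> 'b::topological_space \<Rightarrow> 'c::topological_space"
  assumes "\<And>i. continuous_on UNIV (h i)"
  shows "continuous_on UNIV (\<lambda>(i, t). h i t)"
proof (subst continuous_on_open_vimage[OF open_UNIV], intro allI impI)
  fix V :: "'c set" assume "open V"
  have "open (h i -` V)" for i
    using assms[of i] \<open>open V\<close> by (simp add: continuous_on_open_vimage)
  then have "open (\<Union>i. {i} \<times> (h i -` V))"
    by (intro open_UN ballI open_Times Discrete_Topology.open_discrete)
  also have "(\<Union>i. {i} \<times> (h i -` V)) = (\<lambda>(i, t). h i t) -` V \<inter> UNIV" by auto
  finally show "open ((\<lambda>(i, t). h i t) -` V \<inter> UNIV)" .
qed

text \<open>The orientation \<open>s j\<close> treats both kinds of basin at once: the region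
  \<open>{x. s j * p j \<le> s j * x}\<close> is \<open>{..p j}\<close> for \<open>s j = -1\<close> and \<open>{p j..}\<close> for \<open>s j = 1\<close>.
  The assumption \<open>inward\<close> says that the vector field does not point out of the region at its
  endpoint, for arbitrary inputs of size at most \<open>B j\<close> from the other components.\<close>

locale delay_network =
  fixes N M :: nat
    and c J :: "nat \<Rightarrow> real \<Rightarrow> real" and a \<kappa> :: "nat \<Rightarrow> nat \<Rightarrow> nat \<Rightarrow> real \<Rightarrow> real"
    and G :: "nat \<Rightarrow> real \<Rightarrow> real"
    and r :: real and c0 B L \<xi> s p :: "nat \<Rightarrow> real" and A :: "nat \<Rightarrow> nat \<Rightarrow> nat \<Rightarrow> real"
  assumes c_cont: "\<And>i. i < N \<Longrightarrow> continuous_on UNIV (c i)"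
    and c_ge: "\<And>i t. i < N \<Longrightarrow> c0 i \<le> c i t" and c0_pos: "\<And>i. i < N \<Longrightarrow> c0 i > 0"
    and a_cont: "\<And>i j l. i < N \<Longrightarrow> j < N \<Longrightarrow> l < M \<Longrightarrow> continuous_on UNIV (a i j l)"
    and a_le: "\<And>i j l t. i < N \<Longrightarrow> j < N \<Longrightarrow> l < M \<Longrightarrow> \<bar>a i j l t\<bar> \<le> A i j l"
    and \<kappa>_cont: "\<And>i j l. i < N \<Longrightarrow> j < N \<Longrightarrow> l < M \<Longrightarrow> continuous_on UNIV (\<kappa> i j l)"
    and \<kappa>_pos: "\<And>i j l t. i < N \<Longrightarrow> j < N \<Longrightarrow> l < M \<Longrightarrow> 0 < \<kappa> i j l t"
    and \<kappa>_le: "\<And>i j l t. i < N \<Longrightarrow> j < N \<Longrightarrow> l < M \<Longrightarrow> \<kappa> i j l t \<le> r"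
    and J_cont: "\<And>i. i < N \<Longrightarrow> continuous_on UNIV (J i)"
    and J_bounded: "\<And>i. i < N \<Longrightarrow> \<exists>K. \<forall>t. \<bar>J i t\<bar> \<le> K"
    and G_bound: "\<And>j x. j < N \<Longrightarrow> \<bar>G j x\<bar> \<le> B j"
    and G_lip: "\<And>j x y. j < N \<Longrightarrow> s j * p j \<le> s j * x \<Longrightarrow> s j * p j \<le> s j * y \<Longrightarrow>
                  \<bar>G j x - G j y\<bar> \<le> L j * \<bar>x - y\<bar>"
    and L_nonneg: "\<And>j. j < N \<Longrightarrow> 0 \<le> L j"
    and r_pos: "0 < r"
    and s_sign: "\<And>j. j < N \<Longrightarrow> s j = 1 \<or> s j = -1"
    and \<xi>_pos: "\<And>j. j < N \<Longrightarrow> 0 < \<xi> j"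
    and dominant: "\<And>i. i < N \<Longrightarrow> (\<Sum>l<M. \<Sum>j<N. A i j l * (L j * \<xi> j)) < c0 i * \<xi> i"
    and inward: "\<And>i y t. i < N \<Longrightarrow> (\<And>j l. j < N \<Longrightarrow> l < M \<Longrightarrow> \<bar>y j l\<bar> \<le> B j) \<Longrightarrow>
                   (\<And>l. l < M \<Longrightarrow> \<exists>x. s i * p i \<le> s i * x \<and> y i l = G i x) \<Longrightarrow>
                   c i t * (s i * p i) \<le> s i * ((\<Sum>l<M. \<Sum>j<N. a i j l t * y j l) + J i t)"
begin

definition in_region :: "nat \<Rightarrow> real \<Rightarrow> bool" where
  "in_region j x \<longleftrightarrow> s j * p j \<le> s j * x"

text \<open>Because \<open>s j * s j = 1\<close>, this is the nearest-point projection to the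
  region: \<open>min (p j) x\<close> for \<open>s j = -1\<close> and \<open>max (p j) x\<close> for
  \<open>s j = 1\<close>.\<close>

definition clamp :: "nat \<Rightarrow> real \<Rightarrow> real" where
  "clamp j x = s j * max (s j * p j) (s j * x)"

definition input :: "(nat \<Rightarrow> real \<Rightarrow> real) \<Rightarrow> nat \<Rightarrow> real \<Rightarrow> real" where
  "input u i t = (\<Sum>l<M. \<Sum>j<N. a i j l t * G j (u j (t - \<kappa> i j l t))) + J i t"

definition clamped :: "(nat \<Rightarrow> real \<Rightarrow> real) \<Rightarrow> nat \<Rightarrow> real \<Rightarrow> real" where
  "clamped u = (\<lambda>j t. clamp j (u j t))"

definition row_sum :: "nat \<Rightarrow> real" where
  "row_sum i = (\<Sum>l<M. \<Sum>j<N. A i j l * (L j * \<xi> j))"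

lemma A_nonneg: "i < N \<Longrightarrow> j < N \<Longrightarrow> l < M \<Longrightarrow> 0 \<le> A i j l"
  using a_le[of i j l 0] by linarith

lemma row_sum_nonneg: "i < N \<Longrightarrow> 0 \<le> row_sum i"
  unfolding row_sum_def
  by (intro sum_nonneg mult_nonneg_nonneg A_nonneg L_nonneg less_imp_le[OF \<xi>_pos]) auto

lemma in_region_clamp: "j < N \<Longrightarrow> in_region j (clamp j x)"
  using s_sign[of j] by (auto simp: in_region_def clamp_def)

lemma clamp_eq: "j < N \<Longrightarrow> in_region j x \<Longrightarrow> clamp j x = x"
  using s_sign[of j] by (auto simp: in_region_def clamp_def)

lemma clamp_lip: "j < N \<Longrightarrow> \<bar>clamp j x - clamp j y\<bar> \<le> \<bar>x - y\<bar>"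
  using s_sign[of j] by (auto simp: clamp_def max_def)

lemma G_clamp_lip: "j < N \<Longrightarrow> \<bar>G j (clamp j x) - G j (clamp j y)\<bar> \<le> L j * \<bar>x - y\<bar>"
  using G_lip[of j "clamp j x" "clamp j y"] in_region_clamp[of j x] in_region_clamp[of j y]
    mult_left_mono[OF clamp_lip L_nonneg, of j j x y]
  unfolding in_region_def by linarith

lemma continuous_G_clamp: "j < N \<Longrightarrow> continuous_on UNIV (\<lambda>x. G j (clamp j x))"
  by (rule lipschitz_on_continuous_on[of "L j"], rule lipschitz_onI)
    (use G_clamp_lip L_nonneg in \<open>auto simp: dist_real_def\<close>)

lemma input_bounded: "i < N \<Longrightarrow> \<exists>K. \<forall>u t. \<bar>input u i t\<bar> \<le> K"
proof -
  assume i: "i < N"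
  obtain K where K: "\<And>t. \<bar>J i t\<bar> \<le> K" using J_bounded[OF i] by blast
  have "\<bar>input u i t\<bar> \<le> (\<Sum>l<M. \<Sum>j<N. A i j l * B j) + K" for u t
  proof -
    have "\<bar>a i j l t * G j (u j (t - \<kappa> i j l t))\<bar> \<le> A i j l * B j" if "j < N" "l < M" for j l
      using a_le[OF i that] G_bound[OF that(1)] A_nonneg[OF i that]
      by (auto simp: abs_mult intro!: mult_mono)
    then have "\<bar>\<Sum>l<M. \<Sum>j<N. a i j l t * G j (u j (t - \<kappa> i j l t))\<bar> \<le> (\<Sum>l<M. \<Sum>j<N. A i j l * B j)"
      by (intro sum_abs[THEN order_trans] sum_mono) auto
    then show ?thesis unfolding input_def using K[of t] by linarith
  qed
  then show ?thesis by blast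
qed

text \<open>The inputs are arbitrary numbers \<open>y j l\<close> and \<open>z j l\<close> because
  two situations are covered: two trajectories read at the same delayed times, and one trajectory
  read at the different delayed times of a translate.\<close>

lemma coupling_diff_le:
  assumes i: "i < N"
    and le: "\<And>j l. j < N \<Longrightarrow> l < M \<Longrightarrow> \<bar>y j l - z j l\<bar> \<le> L j * (\<xi> j * D)"
  shows "\<bar>(\<Sum>l<M. \<Sum>j<N. a i j l t * y j l) - (\<Sum>l<M. \<Sum>j<N. a i j l t * z j l)\<bar> \<le> row_sum i * D"
proof -
  have "(\<Sum>l<M. \<Sum>j<N. a i j l t * y j l) - (\<Sum>l<M. \<Sum>j<N. a i j l t * z j l)
      = (\<Sum>l<M. \<Sum>j<N. a i j l t * (y j l - z j l))"
    by (simp add: sum_subtractf right_diff_distrib)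
  moreover have "\<bar>\<dots>\<bar> \<le> (\<Sum>l<M. \<Sum>j<N. A i j l * (L j * (\<xi> j * D)))"
  proof (intro sum_abs[THEN order_trans] sum_mono)
    fix l j assume "l \<in> {..<M}" "j \<in> {..<N}"
    then show "\<bar>a i j l t * (y j l - z j l)\<bar> \<le> A i j l * (L j * (\<xi> j * D))"
      using a_le[OF i, of j l t] le[of j l] A_nonneg[OF i, of j l]
      by (auto simp: abs_mult intro!: mult_mono)
  qed
  moreover have "\<dots> = row_sum i * D"
    by (simp add: row_sum_def sum_distrib_right mult.assoc)
  ultimately show ?thesis by simp
qed

lemma input_clamped_diff_le:
  assumes "i < N"
    and "\<And>j l. j < N \<Longrightarrow> l < M \<Longrightarrow> \<bar>u j (t - \<kappa> i j l t) - v j (t - \<kappa> i j l t)\<bar> \<le> \<xi> j * D"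
  shows "\<bar>input (clamped u) i t - input (clamped v) i t\<bar> \<le> row_sum i * D"
  unfolding input_def clamped_def add_diff_cancel_right
  by (rule coupling_diff_le[OF assms(1)], rule order_trans[OF G_clamp_lip])
    (use assms(2) L_nonneg in \<open>auto intro!: mult_left_mono\<close>)

lemma continuous_input_clamped:
  assumes i: "i < N" and u: "\<And>j. j < N \<Longrightarrow> continuous_on UNIV (u j)"
  shows "continuous_on UNIV (input (clamped u) i)"
proof -
  have "continuous_on UNIV (\<lambda>t. G j (clamp j (u j (t - \<kappa> i j l t))))" if "j < N" "l < M" for j l
  proof (rule continuous_on_compose2[OF continuous_G_clamp[OF that(1)]])
    show "continuous_on UNIV (\<lambda>t. u j (t - \<kappa> i j l t))"
      by (rule continuous_on_compose2[OF u[OF that(1)]])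
        (auto intro!: continuous_intros \<kappa>_cont i that)
  qed simp
  then show ?thesis
    unfolding input_def clamped_def
    by (auto intro!: continuous_intros a_cont J_cont i)
qed

text \<open>Clamping already puts the component's own inputs into the region, whatever
  \<open>u\<close> is. So solutions of the clamped system are confined by comparison first, and the
  clamps are removed afterwards.\<close>

lemma input_clamped_inward:
  assumes i: "i < N"
  shows "c i t * (s i * p i) \<le> s i * input (clamped u) i t"
  unfolding input_def
  by (rule inward[OF i], simp add: G_bound)
    (use in_region_clamp[OF i] in \<open>auto simp: in_region_def clamped_def\<close>)

lemma input_inward:
  assumes i: "i < N" and u: "\<And>l. l < M \<Longrightarrow> in_region i (u i (t - \<kappa> i i l t))"
  shows "c i t * (s i * p i) \<le> s i * input u i t"
  unfolding input_def
  by (rule inward[OF i], simp add: G_bound) (use u in \<open>auto simp: in_region_def\<close>)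

lemma input_cong:
  assumes "i < N" and "\<And>j l. j < N \<Longrightarrow> l < M \<Longrightarrow> u j (t - \<kappa> i j l t) = v j (t - \<kappa> i j l t)"
  shows "input u i t = input v i t"
  unfolding input_def using assms by (intro arg_cong2[where f="(+)"] sum.cong refl) auto

lemma input_clamped_eq:
  assumes "i < N" and "\<And>j l. j < N \<Longrightarrow> l < M \<Longrightarrow> in_region j (u j (t - \<kappa> i j l t))"
  shows "input (clamped u) i t = input u i t"
  by (rule input_cong) (use assms in \<open>auto simp: clamped_def clamp_eq\<close>)

text \<open>At \<open>\<mu> = 0\<close> the required inequality is the strict
  \<open>dominant\<close>; by continuity it persists, for all of the finitely many rows, at some
  \<open>\<mu> > 0\<close>. The factor \<open>\<theta>\<close> is the largest quotient of the two
  sides, with 0 inserted so that the maximum exists for \<open>N = 0\<close> too.\<close>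

lemma contraction_constants:
  obtains \<mu> \<theta> where "\<mu> > 0" "0 \<le> \<theta>" "\<theta> < 1" "\<And>i. i < N \<Longrightarrow> \<mu> < c0 i"
    "\<And>i. i < N \<Longrightarrow> row_sum i * exp (\<mu> * r) \<le> \<theta> * ((c0 i - \<mu>) * \<xi> i)"
proof -
  have ev: "\<forall>\<^sub>F \<mu> in at_right 0. \<mu> < c0 i \<and> row_sum i * exp (\<mu> * r) < (c0 i - \<mu>) * \<xi> i" if "i < N" for i
  proof (rule eventually_conj)
    show "\<forall>\<^sub>F \<mu> in at_right 0. \<mu> < c0 i"
      using c0_pos[OF that] by (auto simp: eventually_at_right)
    have "((\<lambda>\<mu>. (c0 i - \<mu>) * \<xi> i - row_sum i * exp (\<mu> * r)) \<longlongrightarrow> (c0 i - 0) * \<xi> i - row_sum i * exp (0 * r)) (at_right 0)"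
      by (intro tendsto_intros)
    moreover have "(c0 i - 0) * \<xi> i - row_sum i * exp (0 * r) > 0"
      using dominant[OF that] by (simp add: row_sum_def)
    ultimately have "\<forall>\<^sub>F \<mu> in at_right 0. 0 < (c0 i - \<mu>) * \<xi> i - row_sum i * exp (\<mu> * r)"
      by (rule order_tendstoD(1))
    then show "\<forall>\<^sub>F \<mu> in at_right 0. row_sum i * exp (\<mu> * r) < (c0 i - \<mu>) * \<xi> i"
      by eventually_elim simp
  qed
  have "\<forall>\<^sub>F \<mu> in at_right (0::real). 0 < \<mu> \<and> (\<forall>i\<in>{..<N}. \<mu> < c0 i \<and> row_sum i * exp (\<mu> * r) < (c0 i - \<mu>) * \<xi> i)"
  proof (rule eventually_conj)
    show "\<forall>\<^sub>F \<mu> in at_right (0::real). \<forall>i\<in>{..<N}. \<mu> < c0 i \<and> row_sum i * exp (\<mu> * r) < (c0 i - \<mu>) * \<xi> i"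
      by (rule eventually_ball_finite) (use ev in auto)
  qed (rule eventually_at_right_less)
  then have "\<exists>\<mu>>0. \<forall>i\<in>{..<N}. \<mu> < c0 i \<and> row_sum i * exp (\<mu> * r) < (c0 i - \<mu>) * \<xi> i"
    by (rule eventually_happens'[OF trivial_limit_at_right_real])
  then obtain \<mu> where "0 < \<mu>" and \<mu>: "\<And>i. i < N \<Longrightarrow> \<mu> < c0 i"
    "\<And>i. i < N \<Longrightarrow> row_sum i * exp (\<mu> * r) < (c0 i - \<mu>) * \<xi> i"
    by auto
  define q where "q i = row_sum i * exp (\<mu> * r) / ((c0 i - \<mu>) * \<xi> i)" for i
  define \<theta> where "\<theta> = Max (insert 0 (q ` {..<N}))"
  have pos: "0 < (c0 i - \<mu>) * \<xi> i" if "i < N" for i using \<mu>(1) \<xi>_pos that by simp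
  show thesis
  proof (rule that[OF \<open>0 < \<mu>\<close>, of \<theta>])
    show "0 \<le> \<theta>" unfolding \<theta>_def by (rule Max_ge) auto
    show "\<theta> < 1" unfolding \<theta>_def using \<mu>(2) pos by (auto simp: q_def)
    fix i assume i: "i < N"
    have "q i \<le> \<theta>" unfolding \<theta>_def using i by (intro Max_ge) auto
    then show "row_sum i * exp (\<mu> * r) \<le> \<theta> * ((c0 i - \<mu>) * \<xi> i)"
      using pos[OF i] by (simp add: q_def pos_divide_le_eq)
  qed (use \<mu> in auto)
qed

lemma contraction_constant:
  obtains \<theta> where "0 \<le> \<theta>" "\<theta> < 1" "\<And>i. i < N \<Longrightarrow> row_sum i \<le> \<theta> * (c0 i * \<xi> i)"
proof (rule contraction_constants)
  fix \<mu> \<theta> :: real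
  assume \<mu>: "\<mu> > 0" "0 \<le> \<theta>" "\<theta> < 1" "\<And>i. i < N \<Longrightarrow> \<mu> < c0 i"
    "\<And>i. i < N \<Longrightarrow> row_sum i * exp (\<mu> * r) \<le> \<theta> * ((c0 i - \<mu>) * \<xi> i)"
  show thesis
  proof (rule that[OF \<mu>(2,3)])
    fix i assume i: "i < N"
    have "row_sum i \<le> row_sum i * exp (\<mu> * r)"
      using row_sum_nonneg[OF i] \<mu>(1) r_pos by (simp add: mult_le_cancel_left1)
    also have "\<dots> \<le> \<theta> * ((c0 i - \<mu>) * \<xi> i)" using \<mu>(5)[OF i] .
    also have "\<dots> \<le> \<theta> * (c0 i * \<xi> i)"
      using \<mu>(1,2) \<xi>_pos[OF i] by (intro mult_left_mono mult_right_mono) auto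
    finally show "row_sum i \<le> \<theta> * (c0 i * \<xi> i)" .
  qed
qed

text \<open>\<open>S i\<close> stands for any solution operator of \<open>x' = - c i * x + f\<close> with gain at most \<open>1 / c0 i\<close>:
  for the bounded solution on the whole line as well as for an initial value problem.\<close>

lemma clamped_fixed_point:
  fixes S :: "nat \<Rightarrow> (real \<Rightarrow> real) \<Rightarrow> real \<Rightarrow> real"
  assumes S_good: "\<And>i f K. i < N \<Longrightarrow> continuous_on UNIV f \<Longrightarrow> (\<And>t. \<bar>f t\<bar> \<le> K) \<Longrightarrow>
      continuous_on UNIV (S i f) \<and> bounded (range (S i f))"
    and S_lip: "\<And>i f g K D t. i < N \<Longrightarrow> continuous_on UNIV f \<Longrightarrow> continuous_on UNIV g \<Longrightarrow>
      (\<And>t. \<bar>f t\<bar> \<le> K) \<Longrightarrow> (\<And>t. \<bar>g t\<bar> \<le> K) \<Longrightarrow> 0 \<le> D \<Longrightarrow>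
      (\<And>t. \<bar>f t - g t\<bar> \<le> c0 i * D) \<Longrightarrow> \<bar>S i f t - S i g t\<bar> \<le> D"
  shows "\<exists>u. \<forall>i<N. continuous_on UNIV (u i) \<and> bounded (range (u i)) \<and> u i = S i (input (clamped u) i)"
proof -
  obtain \<theta> where \<theta>: "0 \<le> \<theta>" "\<theta> < 1" "\<And>i. i < N \<Longrightarrow> row_sum i \<le> \<theta> * (c0 i * \<xi> i)"
    using contraction_constant by blast
  txt \<open>The index type is \<open>nat discrete\<close>, not \<open>nat\<close>, because bounded continuous functions are an
    instance of \<open>complete_space\<close> only over a metric domain.\<close>
  define E where "E x j t = \<xi> j * apply_bcontfun x (discrete j, t)" for x :: "(nat discrete \<times> real) \<Rightarrow>\<^sub>C real" and j t
  define I where "I x i = input (clamped (E x)) i" for x i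
  \<comment> \<open>Multiplying by \<open>\<xi> j\<close> in \<open>E\<close> and dividing by
    \<open>\<xi> i\<close> here turns the plain sup metric into the \<open>\<xi>\<close>-weighted
    one. Indices from \<open>N\<close> on carry no equation and get the value 0.\<close>
  define T where "T x = (\<lambda>(k, t). let i = of_discrete k in if i < N then S i (I x i) t / \<xi> i else 0)" for x
  have contE: "continuous_on UNIV (E x j)" for x j
  proof -
    have "continuous_on UNIV (\<lambda>t. apply_bcontfun x (discrete j, t))"
      by (rule continuous_on_compose2[OF continuous_on_apply_bcontfun[of UNIV x]]) (auto intro!: continuous_intros)
    then show ?thesis unfolding E_def[abs_def] by (intro continuous_intros)
  qed
  have bddE: "bounded (range (E x j))" for x j
  proof -
    have "range (E x j) \<subseteq> (\<lambda>y. \<xi> j *\<^sub>R y) ` range (apply_bcontfun x)" by (auto simp: E_def)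
    then show ?thesis
      using bounded_scaling[OF bounded_apply_bcontfun, of "\<xi> j" x] bounded_subset by blast
  qed
  have I: "continuous_on UNIV (I x i)" if "i < N" for x i
    unfolding I_def by (rule continuous_input_clamped[OF that contE])
  have IK: "\<exists>K. \<forall>x t. \<bar>I x i t\<bar> \<le> K" if "i < N" for i
    using input_bounded[OF that] unfolding I_def by blast
  have SI: "continuous_on UNIV (S i (I x i)) \<and> bounded (range (S i (I x i)))" if i: "i < N" for x i
    using S_good[OF i I[OF i]] IK[OF i] by blast
  have T: "T x \<in> bcontfun" for x
    unfolding bcontfun_def mem_Collect_eq
  proof (rule conjI)
    show "continuous_on UNIV (T x)"
      unfolding T_def
    proof (rule continuous_on_discrete_Times)
      fix k :: "nat discrete"
      show "continuous_on UNIV (\<lambda>t. let i = of_discrete k in if i < N then S i (I x i) t / \<xi> i else 0)"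
        using SI[of "of_discrete k" x] \<xi>_pos[of "of_discrete k"]
        by (cases "of_discrete k < N") (auto simp: Let_def intro!: continuous_intros)
    qed
    have "bounded (\<Union>i\<in>{..<N}. (\<lambda>y. (1 / \<xi> i) *\<^sub>R y) ` range (S i (I x i)))"
    proof (intro bounded_UN ballI)
      fix i assume "i \<in> {..<N}"
      then show "bounded ((\<lambda>y. (1 / \<xi> i) *\<^sub>R y) ` range (S i (I x i)))"
        using SI[of i x] by (intro bounded_scaling) auto
    qed simp
    then have "bounded (insert 0 (\<Union>i\<in>{..<N}. (\<lambda>y. (1 / \<xi> i) *\<^sub>R y) ` range (S i (I x i))))" by simp
    moreover have "range (T x) \<subseteq> insert 0 (\<Union>i\<in>{..<N}. (\<lambda>y. (1 / \<xi> i) *\<^sub>R y) ` range (S i (I x i)))"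
    proof (rule image_subsetI)
      fix kt :: "nat discrete \<times> real"
      obtain k t where "kt = (k, t)" by force
      moreover define i where "i = of_discrete k"
      moreover have "S i (I x i) t / \<xi> i \<in> (\<lambda>y. (1 / \<xi> i) *\<^sub>R y) ` range (S i (I x i))"
        by (rule image_eqI[of _ _ "S i (I x i) t"]) auto
      ultimately show "T x kt \<in> insert 0 (\<Union>i\<in>{..<N}. (\<lambda>y. (1 / \<xi> i) *\<^sub>R y) ` range (S i (I x i)))"
        unfolding T_def Let_def by (cases "i < N") auto
    qed
    ultimately show "bounded (range (T x))" using bounded_subset by blast
  qed
  have T_app: "apply_bcontfun (Bcontfun (T x)) = T x" for x
    by (rule Bcontfun_inverse[OF T])
  have "\<exists>!x. Bcontfun (T x) = x"
  proof (rule banach_fix_type[where f="\<lambda>x. Bcontfun (T x)", OF \<theta>(1,2)], intro allI dist_bound)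
    fix x y :: "(nat discrete \<times> real) \<Rightarrow>\<^sub>C real" and kt :: "nat discrete \<times> real"
    obtain k t where kt: "kt = (k, t)" by force
    define i where "i = of_discrete k"
    show "dist (apply_bcontfun (Bcontfun (T x)) kt) (apply_bcontfun (Bcontfun (T y)) kt) \<le> \<theta> * dist x y"
    proof (cases "i < N")
      case False
      then show ?thesis unfolding T_app kt using \<theta>(1) by (simp add: T_def i_def[symmetric])
    next
      case i: True
      obtain K where K: "\<And>x t. \<bar>I x i t\<bar> \<le> K" using IK[OF i] by blast
      have "\<bar>S i (I x i) t - S i (I y i) t\<bar> \<le> \<theta> * \<xi> i * dist x y"
      proof (rule S_lip[OF i I[OF i] I[OF i] K K])
        show "0 \<le> \<theta> * \<xi> i * dist x y" using \<theta>(1) \<xi>_pos[OF i] by simp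
        fix t
        have "\<bar>I x i t - I y i t\<bar> \<le> row_sum i * dist x y"
          unfolding I_def
        proof (rule input_clamped_diff_le[OF i])
          fix j l assume "j < N" "l < M"
          then show "\<bar>E x j (t - \<kappa> i j l t) - E y j (t - \<kappa> i j l t)\<bar> \<le> \<xi> j * dist x y"
            using dist_bounded[of x "(discrete j, t - \<kappa> i j l t)" y] \<xi>_pos[of j]
            by (simp add: E_def abs_mult dist_real_def flip: right_diff_distrib)
        qed
        also have "\<dots> \<le> \<theta> * (c0 i * \<xi> i) * dist x y"
          by (intro mult_right_mono \<theta>(3) i) auto
        finally show "\<bar>I x i t - I y i t\<bar> \<le> c0 i * (\<theta> * \<xi> i * dist x y)"
          by (simp add: algebra_simps)
      qed
      then show ?thesis using i \<xi>_pos[OF i] unfolding T_app kt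
        by (simp add: T_def i_def[symmetric] dist_real_def abs_divide pos_divide_le_eq algebra_simps flip: diff_divide_distrib)
    qed
  qed
  then obtain x where x: "Bcontfun (T x) = x" by blast
  show ?thesis
  proof (intro exI[of _ "E x"] allI impI conjI)
    fix i assume i: "i < N"
    show "continuous_on UNIV (E x i)" by (rule contE)
    show "bounded (range (E x i))" by (rule bddE)
    show "E x i = S i (input (clamped (E x)) i)"
    proof
      fix t
      have "apply_bcontfun x (discrete i, t) = T x (discrete i, t)" using T_app[of x] x by metis
      then show "E x i t = S i (input (clamped (E x)) i) t"
        using i \<xi>_pos[OF i] by (simp add: E_def T_def I_def discrete_inverse)
    qed
  qed
qed

end

lemma uniform_bound_lessThan:
  fixes f :: "nat \<Rightarrow> 'b \<Rightarrow> real"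
  assumes "\<And>i. i < N \<Longrightarrow> \<exists>K. \<forall>t. \<bar>f i t\<bar> \<le> K"
  shows "\<exists>K\<ge>0. \<forall>i<N. \<forall>t. \<bar>f i t\<bar> \<le> K"
  using assms
proof (induction N)
  case (Suc N)
  obtain K where K: "K \<ge> 0" "\<And>i t. i < N \<Longrightarrow> \<bar>f i t\<bar> \<le> K" using Suc by fastforce
  obtain K' where K': "\<And>t. \<bar>f N t\<bar> \<le> K'" using Suc.prems[of N] by blast
  have "\<bar>f i t\<bar> \<le> max K K'" if "i < Suc N" for i t
    using K(2)[of i t] K'[of t] that by (cases "i = N") auto
  then show ?case using K(1) by (intro exI[of _ "max K K'"]) auto
qed auto

section \<open>Existence of entire solutions and of solutions with prescribed history\<close>

context delay_network
begin

text \<open>An upper bound for every \<open>1 / \<xi> i\<close>, hence the constant for passing from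
  an unweighted bound \<open>x\<close> to a weighted bound
  \<open>\<xi> i * (inv_weight_sum * x)\<close>.\<close>

definition inv_weight_sum :: real where
  "inv_weight_sum = (\<Sum>j<N. 1 / \<xi> j)"

lemma inv_weight_sum_nonneg: "0 \<le> inv_weight_sum"
  unfolding inv_weight_sum_def by (intro sum_nonneg) (simp add: less_imp_le \<xi>_pos)

lemma one_le_weight_inv_sum:
  assumes "i < N"
  shows "1 \<le> \<xi> i * inv_weight_sum"
proof -
  have "1 / \<xi> i \<le> inv_weight_sum"
    unfolding inv_weight_sum_def using assms \<xi>_pos by (intro member_le_sum) (auto simp: less_imp_le)
  then show ?thesis using \<xi>_pos[OF assms] by (simp add: pos_divide_le_eq mult.commute)
qed

lemma le_weight_inv_sum: "i < N \<Longrightarrow> 0 \<le> x \<Longrightarrow> x \<le> \<xi> i * (inv_weight_sum * x)"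
  using mult_right_mono[OF one_le_weight_inv_sum, of i x] by (simp add: mult.assoc)

lemma input_diff_le:
  assumes "i < N"
    and "\<And>j l. j < N \<Longrightarrow> l < M \<Longrightarrow> in_region j (u j (t - \<kappa> i j l t))"
    and "\<And>j l. j < N \<Longrightarrow> l < M \<Longrightarrow> in_region j (v j (t - \<kappa> i j l t))"
    and "\<And>j l. j < N \<Longrightarrow> l < M \<Longrightarrow> \<bar>u j (t - \<kappa> i j l t) - v j (t - \<kappa> i j l t)\<bar> \<le> \<xi> j * D"
  shows "\<bar>input u i t - input v i t\<bar> \<le> row_sum i * D"
proof -
  have "\<bar>input (clamped u) i t - input (clamped v) i t\<bar> \<le> row_sum i * D"
    by (rule input_clamped_diff_le) (use assms in auto)
  moreover have "input (clamped u) i t = input u i t"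
    by (rule input_clamped_eq) (use assms in auto)
  moreover have "input (clamped v) i t = input v i t"
    by (rule input_clamped_eq) (use assms in auto)
  ultimately show ?thesis by simp
qed

lemma region_forward:
  assumes i: "i < N" and "0 \<le> t"
    and dv: "\<And>x. 0 \<le> x \<Longrightarrow> x \<le> t \<Longrightarrow> (v has_real_derivative - c i x * v x + f x) (at x within {0..})"
    and f: "\<And>x. 0 \<le> x \<Longrightarrow> x \<le> t \<Longrightarrow> c i x * (s i * p i) \<le> s i * f x"
    and v0: "in_region i (v 0)"
  shows "in_region i (v t)"
proof -
  have "- (s i * v t) \<le> - (s i * p i)"
  proof (rule linear_comparison_forward[where w="\<lambda>x. - (s i * v x)", OF c_cont[OF i] c_ge[OF i] less_imp_le[OF c0_pos[OF i]] \<open>0 \<le> t\<close>])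
    fix x assume x: "0 \<le> x" "x \<le> t"
    show "((\<lambda>x. - (s i * v x)) has_real_derivative - (s i * (- c i x * v x + f x))) (at x within {0..})"
      by (intro DERIV_minus DERIV_cmult dv x)
    show "- (s i * (- c i x * v x + f x)) \<le> - c i x * (- (s i * v x) - - (s i * p i))"
      using f[OF x] by (simp add: algebra_simps)
  qed (use v0 in \<open>simp add: in_region_def\<close>)
  then show ?thesis by (simp add: in_region_def)
qed

lemma entire_solution_exists:
  "\<exists>u. \<forall>i<N. bounded (range (u i)) \<and>
     (\<forall>t. in_region i (u i t) \<and> (u i has_real_derivative - c i t * u i t + input u i t) (at t))"
proof -
  define good where "good i f w \<longleftrightarrow> bounded (range w) \<and>
    (\<forall>t. (w has_real_derivative - c i t * w t + f t) (at t))" for i and f w :: "real \<Rightarrow> real"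
  \<comment> \<open>Any bounded solution may be chosen: the gain estimate holds for every pair of
    bounded solutions.\<close>
  define S where "S i f = (SOME w. good i f w)" for i f
  have S: "good i f (S i f)" if i: "i < N" and f: "continuous_on UNIV f" "\<And>t. \<bar>f t\<bar> \<le> K" for i f K
  proof -
    obtain w where w: "\<And>t. (w has_real_derivative - c i t * w t + f t) (at t)" "\<And>t. \<bar>w t\<bar> \<le> K / c0 i"
      using linear_bounded_solution_exists[OF c_cont[OF i] c_ge[OF i] c0_pos[OF i] f] by blast
    then have "good i f w" by (auto simp: good_def bounded_iff)
    then show ?thesis unfolding S_def by (rule someI[of "good i f"])
  qed
  have "\<exists>u. \<forall>i<N. continuous_on UNIV (u i) \<and> bounded (range (u i)) \<and> u i = S i (input (clamped u) i)"
  proof (rule clamped_fixed_point)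
    fix i K and f :: "real \<Rightarrow> real"
    assume "i < N" "continuous_on UNIV f" "\<And>t. \<bar>f t\<bar> \<le> (K::real)"
    then have "good i f (S i f)" by (rule S)
    then show "continuous_on UNIV (S i f) \<and> bounded (range (S i f))"
      unfolding good_def by (auto intro: DERIV_continuous_on)
  next
    fix i K D t and f g :: "real \<Rightarrow> real"
    assume i: "i < N" and f: "continuous_on UNIV f" "\<And>t. \<bar>f t\<bar> \<le> (K::real)"
      and g: "continuous_on UNIV g" "\<And>t. \<bar>g t\<bar> \<le> K"
      and D: "0 \<le> D" "\<And>t. \<bar>f t - g t\<bar> \<le> c0 i * D"
    have dS: "(S i f has_real_derivative - c i t * S i f t + f t) (at t)"
      "(S i g has_real_derivative - c i t * S i g t + g t) (at t)" for t
      using S[OF i f] S[OF i g] by (auto simp: good_def)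
    obtain K1 K2 where K: "\<And>t. \<bar>S i f t\<bar> \<le> K1" "\<And>t. \<bar>S i g t\<bar> \<le> K2"
      using S[OF i f] S[OF i g] by (auto simp: good_def bounded_iff)
    show "\<bar>S i f t - S i g t\<bar> \<le> D"
    proof (rule linear_bounded_abs_le[where w="\<lambda>t. S i f t - S i g t" and f="\<lambda>t. f t - g t", OF c_cont[OF i] c_ge[OF i] c0_pos[OF i]])
      fix t
      show "((\<lambda>t. S i f t - S i g t) has_real_derivative - c i t * (S i f t - S i g t) + (f t - g t)) (at t)"
        using DERIV_diff[OF dS[of t]] by (simp add: algebra_simps)
      show "\<bar>S i f t - S i g t\<bar> \<le> K1 + K2" using K[of t] by linarith
    qed (use D in auto)
  qed
  then obtain u where u: "\<And>i. i < N \<Longrightarrow> continuous_on UNIV (u i)" "\<And>i. i < N \<Longrightarrow> bounded (range (u i))"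
    "\<And>i. i < N \<Longrightarrow> u i = S i (input (clamped u) i)" by blast
  have du: "(u i has_real_derivative - c i t * u i t + input (clamped u) i t) (at t)" if i: "i < N" for i t
  proof -
    obtain K where K: "\<And>t. \<bar>input (clamped u) i t\<bar> \<le> K" using input_bounded[OF i] by blast
    have "good i (input (clamped u) i) (S i (input (clamped u) i))"
      by (rule S[OF i continuous_input_clamped[OF i u(1)] K])
    then show ?thesis unfolding good_def u(3)[OF i, symmetric] by blast
  qed
  have reg: "in_region i (u i t)" if i: "i < N" for i t
  proof -
    obtain K where K: "\<And>t. \<bar>u i t\<bar> \<le> K" using u(2)[OF i] by (auto simp: bounded_iff)
    have "- (s i * u i t) \<le> - (s i * p i)"
    proof (rule linear_comparison_bounded[where w="\<lambda>x. - (s i * u i x)", OF c_cont[OF i] c_ge[OF i] c0_pos[OF i]])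
      fix x
      show "((\<lambda>x. - (s i * u i x)) has_real_derivative - (s i * (- c i x * u i x + input (clamped u) i x))) (at x)"
        by (intro DERIV_minus DERIV_cmult du i)
      show "- (s i * (- c i x * u i x + input (clamped u) i x)) \<le> - c i x * (- (s i * u i x) - - (s i * p i))"
        using input_clamped_inward[OF i, of x u] by (simp add: algebra_simps)
      show "\<bar>- (s i * u i x)\<bar> \<le> K" using K[of x] s_sign[OF i] by auto
    qed
    then show ?thesis by (simp add: in_region_def)
  qed
  have "input (clamped u) i t = input u i t" if "i < N" for i t
    by (rule input_clamped_eq[OF that reg])
  then show ?thesis using u du reg by (intro exI[of _ u]) auto
qed

lemma ivp_solution_exists:
  assumes \<phi>: "\<And>i. i < N \<Longrightarrow> continuous_on {-r..0} (\<phi> i)"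
    and \<phi>_reg: "\<And>i x. i < N \<Longrightarrow> -r \<le> x \<Longrightarrow> x \<le> 0 \<Longrightarrow> in_region i (\<phi> i x)"
  shows "\<exists>v. \<forall>i<N. (\<forall>x\<in>{-r..0}. v i x = \<phi> i x) \<and>
     (\<forall>t\<ge>0. (v i has_real_derivative - c i t * v i t + input v i t) (at t within {0..}))"
proof -
  \<comment> \<open>The history is continued constantly to the left of \<open>-r\<close> to obtain a
    continuous function on the whole line that stays in the region. For \<open>t \<ge> 0\<close> the
    equation never reads these values, since delays are at most \<open>r\<close>.\<close>
  define good where "good i f w \<longleftrightarrow> continuous_on UNIV w \<and> (\<forall>t\<le>0. w t = \<phi> i (max (-r) t)) \<and>
    (\<forall>t\<ge>0. (w has_real_derivative - c i t * w t + f t) (at t within {0..}))" for i and f w :: "real \<Rightarrow> real"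
  define S where "S i f = (SOME w. good i f w)" for i f
  have S: "good i f (S i f)" if i: "i < N" and f: "continuous_on UNIV f" for i f
  proof -
    have "continuous_on {..0} (\<lambda>t. \<phi> i (max (-r) t))"
      by (rule continuous_on_compose2[OF \<phi>[OF i]]) (use r_pos in \<open>auto intro!: continuous_intros\<close>)
    then have "\<exists>w. good i f w"
      unfolding good_def by (rule linear_ivp_solution_exists[OF c_cont[OF i] f])
    then show ?thesis unfolding S_def by (rule someI_ex)
  qed
  have "\<exists>u. \<forall>i<N. continuous_on UNIV (u i) \<and> bounded (range (u i)) \<and> u i = S i (input (clamped u) i)"
  proof (rule clamped_fixed_point)
    fix i K and f :: "real \<Rightarrow> real"
    assume i: "i < N" and f: "continuous_on UNIV f" "\<And>t. \<bar>f t\<bar> \<le> (K::real)"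
    have g: "good i f (S i f)" by (rule S[OF i f(1)])
    have "bounded (\<phi> i ` {-r..0})"
      by (intro compact_imp_bounded compact_continuous_image \<phi> i) auto
    then obtain K1 where "\<forall>y\<in>\<phi> i ` {-r..0}. norm y \<le> K1" unfolding bounded_iff by blast
    then have K1: "\<bar>\<phi> i x\<bar> \<le> K1" if "-r \<le> x" "x \<le> 0" for x using that by simp
    have Sneg: "\<bar>S i f t\<bar> \<le> K1" if "t \<le> 0" for t
      using g K1[of "max (-r) t"] that r_pos by (simp add: good_def)
    have "\<bar>S i f t\<bar> \<le> max K1 (K / c0 i)" for t
    proof (cases "t \<le> 0")
      case False
      show ?thesis
      proof (rule linear_forward_abs_le[where w="S i f" and f=f, OF c_cont[OF i] c_ge[OF i] c0_pos[OF i]])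
        fix x :: real assume "0 \<le> x"
        then show "(S i f has_real_derivative - c i x * S i f x + f x) (at x within {0..})"
          using g by (simp add: good_def)
        have "K = c0 i * (K / c0 i)" using c0_pos[OF i] by simp
        also have "\<dots> \<le> c0 i * max K1 (K / c0 i)" using c0_pos[OF i] by (intro mult_left_mono) auto
        finally show "\<bar>f x\<bar> \<le> c0 i * max K1 (K / c0 i)" using f(2)[of x] by linarith
      qed (use False Sneg[of 0] in auto)
    qed (use Sneg in fastforce)
    then show "continuous_on UNIV (S i f) \<and> bounded (range (S i f))"
      using g by (auto simp: good_def bounded_iff)
  next
    fix i D and f g :: "real \<Rightarrow> real" and t :: real
    assume i: "i < N" and f: "continuous_on UNIV f" and g: "continuous_on UNIV g"
      and D: "0 \<le> D" "\<And>t. \<bar>f t - g t\<bar> \<le> c0 i * (D :: real)"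
    note gd = S[OF i f] S[OF i g]
    show "\<bar>S i f t - S i g t\<bar> \<le> D"
    proof (cases "t \<le> 0")
      case True
      then show ?thesis using gd D by (simp add: good_def)
    next
      case False
      show ?thesis
      proof (rule linear_forward_abs_le[where w="\<lambda>t. S i f t - S i g t" and f="\<lambda>t. f t - g t", OF c_cont[OF i] c_ge[OF i] c0_pos[OF i]])
        fix x :: real assume x: "0 \<le> x"
        then have dS: "(S i f has_real_derivative - c i x * S i f x + f x) (at x within {0..})"
          "(S i g has_real_derivative - c i x * S i g x + g x) (at x within {0..})"
          using gd by (auto simp: good_def)
        show "((\<lambda>t. S i f t - S i g t) has_real_derivative - c i x * (S i f x - S i g x) + (f x - g x)) (at x within {0..})"
          using DERIV_diff[OF dS] by (simp add: algebra_simps)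
      qed (use D False gd in \<open>auto simp: good_def\<close>)
    qed
  qed
  then obtain u where u: "\<And>i. i < N \<Longrightarrow> continuous_on UNIV (u i)"
    "\<And>i. i < N \<Longrightarrow> u i = S i (input (clamped u) i)" by blast
  have gu: "good i (input (clamped u) i) (u i)" if i: "i < N" for i
  proof -
    have "continuous_on UNIV (input (clamped u) i)" by (rule continuous_input_clamped[OF i u(1)])
    from S[OF i this] show ?thesis unfolding u(2)[OF i, symmetric] .
  qed
  have reg: "in_region i (u i t)" if i: "i < N" for i t
  proof (cases "t \<le> 0")
    case True
    then show ?thesis using gu[OF i] \<phi>_reg[OF i, of "max (-r) t"] r_pos by (simp add: good_def)
  next
    case False
    show ?thesis
      by (rule region_forward[where v="u i", OF i, where f="input (clamped u) i"])
        (use False gu[OF i] input_clamped_inward[OF i] \<phi>_reg[OF i, of 0] r_pos in \<open>auto simp: good_def\<close>)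
  qed
  have "input (clamped u) i t = input u i t" if "i < N" for i t
    by (rule input_clamped_eq[OF that reg])
  then show ?thesis using gu by (intro exI[of _ u]) (auto simp: good_def)
qed

end

section \<open>Invariance, stability and almost periodicity\<close>

context delay_network
begin

lemma delay_lower_bound:
  assumes i: "i < N" and "0 \<le> T"
  obtains \<delta> where "\<delta> > 0" "\<And>l x. l < M \<Longrightarrow> 0 \<le> x \<Longrightarrow> x \<le> T \<Longrightarrow> \<delta> \<le> \<kappa> i i l x"
proof -
  have "\<exists>d>0. \<forall>x\<in>{0..T}. d \<le> \<kappa> i i l x" if "l < M" for l
  proof -
    have "\<exists>x\<in>{0..T}. \<forall>y\<in>{0..T}. \<kappa> i i l x \<le> \<kappa> i i l y"
      using \<open>0 \<le> T\<close> by (intro continuous_attains_inf continuous_on_subset[OF \<kappa>_cont[OF i i that]]) auto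
    then show ?thesis using \<kappa>_pos[OF i i that] by blast
  qed
  then have "\<forall>l\<in>{..<M}. \<exists>d>0. \<forall>x\<in>{0..T}. d \<le> \<kappa> i i l x" by auto
  from bchoice[OF this] obtain d
    where "\<forall>l\<in>{..<M}. 0 < d l \<and> (\<forall>x\<in>{0..T}. d l \<le> \<kappa> i i l x)" by blast
  then have d: "0 < d l" "0 \<le> x \<Longrightarrow> x \<le> T \<Longrightarrow> d l \<le> \<kappa> i i l x" if "l < M" for l x
    using that by auto
  show thesis
  proof
    show "0 < Min (insert 1 (d ` {..<M}))" using d(1) by auto
    fix l x assume "l < M" "0 \<le> x" "x \<le> T"
    have "Min (insert 1 (d ` {..<M})) \<le> d l" using \<open>l < M\<close> by (intro Min_le) auto
    then show "Min (insert 1 (d ` {..<M})) \<le> \<kappa> i i l x"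
      using d(2)[OF \<open>l < M\<close> \<open>0 \<le> x\<close> \<open>x \<le> T\<close>] by linarith
  qed
qed

text \<open>Only a component's own delayed values need to lie in its region, so the method of steps
  applies to each component separately; the delays are bounded away from \<open>0\<close> merely on compact
  time intervals.\<close>

lemma ivp_in_region:
  assumes hist: "\<And>i x. i < N \<Longrightarrow> -r \<le> x \<Longrightarrow> x \<le> 0 \<Longrightarrow> in_region i (v i x)"
    and dv: "\<And>i t. i < N \<Longrightarrow> 0 \<le> t \<Longrightarrow>
      (v i has_real_derivative - c i t * v i t + input v i t) (at t within {0..})"
    and i: "i < N" and t: "-r \<le> t"
  shows "in_region i (v i t)"
proof (cases "t \<le> 0")
  case False
  then have "0 \<le> t" by simp
  obtain \<delta> where \<delta>: "\<delta> > 0" "\<And>l x. l < M \<Longrightarrow> 0 \<le> x \<Longrightarrow> x \<le> t \<Longrightarrow> \<delta> \<le> \<kappa> i i l x"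
    using delay_lower_bound[OF i \<open>0 \<le> t\<close>] by blast
  \<comment> \<open>Up to time \<open>real (Suc n) * \<delta>\<close> the delayed arguments
    \<open>y - \<kappa> i i l y\<close> are at most \<open>real n * \<delta>\<close>, so the
    induction hypothesis covers them.\<close>
  have step: "\<forall>x. -r \<le> x \<and> x \<le> t \<and> x \<le> real n * \<delta> \<longrightarrow> in_region i (v i x)" for n
  proof (induction n)
    case 0
    then show ?case using hist[OF i] by simp
  next
    case (Suc n)
    show ?case
    proof (intro allI impI)
      fix x assume x: "-r \<le> x \<and> x \<le> t \<and> x \<le> real (Suc n) * \<delta>"
      show "in_region i (v i x)"
      proof (cases "x \<le> 0")
        case False
        show ?thesis
        proof (rule region_forward[where v="v i" and f="input v i", OF i])
          fix y assume y: "0 \<le> y" "y \<le> x"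
          show "c i y * (s i * p i) \<le> s i * input v i y"
          proof (rule input_inward[OF i])
            fix l assume l: "l < M"
            have "\<delta> \<le> \<kappa> i i l y" using \<delta>(2)[OF l] y x by auto
            moreover have "\<kappa> i i l y \<le> r" using \<kappa>_le[OF i i l] .
            moreover have "y \<le> real n * \<delta> + \<delta>" using x y by (simp add: algebra_simps)
            ultimately show "in_region i (v i (y - \<kappa> i i l y))"
              using Suc.IH y x \<delta>(1) by auto
          qed
        qed (use False dv i hist r_pos in auto)
      qed (use x hist i in auto)
    qed
  qed
  obtain n where "t < real n * \<delta>" using reals_Archimedean3[OF \<delta>(1)] by blast
  then show ?thesis using step[of n] t by simp
qed (use hist i t in auto)

text \<open>The scaled difference \<open>y i t = exp (\<mu> * t) * (u i t - v i t)\<close> obeys the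
  equation with damping \<open>c i t - \<mu>\<close>. Any weighted bound \<open>W\<close> for it on
  \<open>[-r, T]\<close> improves to \<open>max E (\<theta> * W)\<close>, where \<open>E\<close>
  comes from the history. Iteration starts from a bound by compactness; that bound depends on
  \<open>T\<close>, but only \<open>E\<close> survives in the limit. The constants are obtained
  before \<open>u\<close>, \<open>v\<close> and \<open>D\<close>, hence uniform in the initial
  function.\<close>

lemma exponential_decay:
  assumes "N \<ge> 1"
  obtains \<rho> \<mu> where "1 \<le> \<rho>" "0 < \<mu>"
    "\<And>u v D i t.
      (\<And>i t. i < N \<Longrightarrow> 0 \<le> t \<Longrightarrow> (u i has_real_derivative - c i t * u i t + input u i t) (at t within {0..})) \<Longrightarrow>
      (\<And>i t. i < N \<Longrightarrow> 0 \<le> t \<Longrightarrow> (v i has_real_derivative - c i t * v i t + input v i t) (at t within {0..})) \<Longrightarrow>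
      (\<And>i t. i < N \<Longrightarrow> -r \<le> t \<Longrightarrow> in_region i (u i t) \<and> in_region i (v i t)) \<Longrightarrow>
      (\<And>i t. i < N \<Longrightarrow> -r \<le> t \<Longrightarrow> t \<le> 0 \<Longrightarrow> \<bar>u i t - v i t\<bar> \<le> D) \<Longrightarrow>
      i < N \<Longrightarrow> 0 \<le> t \<Longrightarrow> \<bar>u i t - v i t\<bar> \<le> \<rho> * exp (- \<mu> * t) * D"
proof -
  obtain \<mu> \<theta> where \<mu>: "\<mu> > 0" "0 \<le> \<theta>" "\<theta> < 1" "\<And>i. i < N \<Longrightarrow> \<mu> < c0 i"
    "\<And>i. i < N \<Longrightarrow> row_sum i * exp (\<mu> * r) \<le> \<theta> * ((c0 i - \<mu>) * \<xi> i)"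
    using contraction_constants by blast
  \<comment> \<open>Entering the weighted norm costs \<open>inv_weight_sum\<close> and leaving it
    costs \<open>\<xi> i\<close>; the sum over \<open>i\<close> bounds all these products and, as
    \<open>N \<ge> 1\<close>, is at least 1.\<close>
  define \<rho> where "\<rho> = (\<Sum>i<N. \<xi> i * inv_weight_sum)"
  have \<rho>_ge: "\<xi> i * inv_weight_sum \<le> \<rho>" if "i < N" for i
    unfolding \<rho>_def using that \<xi>_pos inv_weight_sum_nonneg
    by (intro member_le_sum) (auto intro!: mult_nonneg_nonneg simp: less_imp_le)
  have "1 \<le> \<rho>" using one_le_weight_inv_sum[of 0] \<rho>_ge[of 0] assms by simp
  have main: "\<bar>u i T - v i T\<bar> \<le> \<rho> * exp (- \<mu> * T) * D"
    if du: "\<And>i t. i < N \<Longrightarrow> 0 \<le> t \<Longrightarrow> (u i has_real_derivative - c i t * u i t + input u i t) (at t within {0..})"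
      and dv: "\<And>i t. i < N \<Longrightarrow> 0 \<le> t \<Longrightarrow> (v i has_real_derivative - c i t * v i t + input v i t) (at t within {0..})"
      and reg: "\<And>i t. i < N \<Longrightarrow> -r \<le> t \<Longrightarrow> in_region i (u i t) \<and> in_region i (v i t)"
      and hist: "\<And>i t. i < N \<Longrightarrow> -r \<le> t \<Longrightarrow> t \<le> 0 \<Longrightarrow> \<bar>u i t - v i t\<bar> \<le> D"
      and i: "i < N" and T: "0 \<le> T" for u v :: "nat \<Rightarrow> real \<Rightarrow> real" and D i T
  proof -
    have "0 \<le> D" using hist[OF i, of 0] r_pos by simp
    define y where "y i t = exp (\<mu> * t) * (u i t - v i t)" for i t
    define f where "f i t = exp (\<mu> * t) * (input u i t - input v i t)" for i t
    define E where "E = inv_weight_sum * D"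
    have "0 \<le> E" using \<open>0 \<le> D\<close> inv_weight_sum_nonneg by (simp add: E_def)
    have dy: "(y i has_real_derivative - (c i t - \<mu>) * y i t + f i t) (at t within {0..})"
      if "i < N" "0 \<le> t" for i t
      unfolding y_def[abs_def]
      by (rule derivative_eq_intros du dv that refl | simp add: f_def algebra_simps)+
    have hist_y: "\<bar>y i t\<bar> \<le> \<xi> i * E" if "i < N" "-r \<le> t" "t \<le> 0" for i t
    proof -
      have "\<bar>y i t\<bar> \<le> 1 * \<bar>u i t - v i t\<bar>"
        unfolding y_def abs_mult using \<mu>(1) that(3) by (intro mult_right_mono) (auto simp: mult_nonneg_nonpos)
      also have "\<dots> \<le> D" using hist[OF that] by simp
      also have "\<dots> \<le> \<xi> i * E" unfolding E_def by (rule le_weight_inv_sum[OF that(1) \<open>0 \<le> D\<close>])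
      finally show ?thesis .
    qed
    have improve: "\<bar>y i t\<bar> \<le> \<xi> i * max E (\<theta> * W)"
      if W: "\<And>i t. i < N \<Longrightarrow> -r \<le> t \<Longrightarrow> t \<le> T \<Longrightarrow> \<bar>y i t\<bar> \<le> \<xi> i * W"
        and i: "i < N" and t: "-r \<le> t" "t \<le> T" for W i t
    proof (cases "t \<le> 0")
      case True
      have "\<xi> i * E \<le> \<xi> i * max E (\<theta> * W)" using \<xi>_pos[OF i] by (intro mult_left_mono) auto
      then show ?thesis using hist_y[OF i t(1) True] by linarith
    next
      case False
      show ?thesis
      proof (rule linear_forward_abs_le[where w="y i" and f="f i" and c="\<lambda>t. c i t - \<mu>" and ?c0.0="c0 i - \<mu>"])
        show "continuous_on UNIV (\<lambda>t. c i t - \<mu>)" by (intro continuous_intros c_cont i)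
        show "c0 i - \<mu> \<le> c i x - \<mu>" for x using c_ge[OF i] by simp
        show "0 < c0 i - \<mu>" using \<mu>(4)[OF i] by simp
        show "\<bar>y i 0\<bar> \<le> \<xi> i * max E (\<theta> * W)"
          by (rule order_trans[OF hist_y[OF i] mult_left_mono]) (use r_pos \<xi>_pos[OF i] in auto)
        fix x assume x: "0 \<le> x" "x \<le> t"
        show "(y i has_real_derivative - (c i x - \<mu>) * y i x + f i x) (at x within {0..})"
          by (rule dy[OF i x(1)])
        have "\<bar>input u i x - input v i x\<bar> \<le> row_sum i * (exp (- \<mu> * x) * exp (\<mu> * r) * W)"
        proof (rule input_diff_le[OF i])
          fix j l assume jl: "j < N" "l < M"
          let ?x = "x - \<kappa> i j l x"
          have x': "- r \<le> ?x" "?x \<le> T"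
            using \<kappa>_le[OF i jl, of x] \<kappa>_pos[OF i jl, of x] x t by auto
          then show "in_region j (u j ?x)" "in_region j (v j ?x)" using reg jl by auto
          have "\<xi> j * W \<ge> 0" using W[OF jl(1) x'] by linarith
          have "\<bar>u j ?x - v j ?x\<bar> = exp (- \<mu> * ?x) * \<bar>y j ?x\<bar>"
            by (simp add: y_def abs_mult exp_minus)
          also have "\<dots> \<le> exp (- \<mu> * ?x) * (\<xi> j * W)"
            by (intro mult_left_mono W jl x') auto
          also have "\<dots> \<le> (exp (- \<mu> * x) * exp (\<mu> * r)) * (\<xi> j * W)"
          proof (rule mult_right_mono[OF _ \<open>\<xi> j * W \<ge> 0\<close>])
            have "- \<mu> * ?x \<le> - \<mu> * x + \<mu> * r"
              using mult_left_mono[OF \<kappa>_le[OF i jl, of x], of \<mu>] \<mu>(1) by (simp add: algebra_simps)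
            then show "exp (- \<mu> * ?x) \<le> exp (- \<mu> * x) * exp (\<mu> * r)"
              by (simp flip: exp_add)
          qed
          finally show "\<bar>u j ?x - v j ?x\<bar> \<le> \<xi> j * (exp (- \<mu> * x) * exp (\<mu> * r) * W)"
            by (simp add: algebra_simps)
        qed
        then have "\<bar>f i x\<bar> \<le> exp (\<mu> * x) * (row_sum i * (exp (- \<mu> * x) * exp (\<mu> * r) * W))"
          unfolding f_def abs_mult by (simp add: mult_left_mono)
        also have "\<dots> = row_sum i * exp (\<mu> * r) * W" by (simp add: exp_minus)
        also have "\<dots> \<le> \<theta> * ((c0 i - \<mu>) * \<xi> i) * W"
        proof (rule mult_right_mono[OF \<mu>(5)[OF i]])
          have "0 \<le> \<xi> i * W" using W[OF i, of 0] r_pos T by (auto intro: order_trans[OF abs_ge_zero])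
          then show "0 \<le> W" using \<xi>_pos[OF i] by (simp add: zero_le_mult_iff)
        qed
        also have "\<dots> = (c0 i - \<mu>) * \<xi> i * (\<theta> * W)" by simp
        also have "\<dots> \<le> (c0 i - \<mu>) * \<xi> i * max E (\<theta> * W)"
          using \<mu>(4)[OF i] \<xi>_pos[OF i] by (intro mult_left_mono) auto
        finally show "\<bar>f i x\<bar> \<le> (c0 i - \<mu>) * (\<xi> i * max E (\<theta> * W))" by (simp add: mult.assoc)
      qed (use False in auto)
    qed
    have "\<exists>K. \<forall>t. \<bar>if t \<in> {0..T} then y i t else 0\<bar> \<le> K" if "i < N" for i
    proof -
      have "continuous_on {0..} (y i)" by (rule DERIV_continuous_on[OF dy[OF that]]) simp
      then have "bounded (y i ` {0..T})"
        by (intro compact_imp_bounded compact_continuous_image) (auto elim: continuous_on_subset)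
      then obtain K where K: "\<forall>z\<in>y i ` {0..T}. norm z \<le> K" unfolding bounded_iff by blast
      have "\<bar>if t \<in> {0..T} then y i t else 0\<bar> \<le> max K 0" for t
        using K by (auto simp: le_max_iff_disj)
      then show ?thesis by blast
    qed
    from uniform_bound_lessThan[of N "\<lambda>i t. if t \<in> {0..T} then y i t else 0", OF this]
    obtain K where "0 \<le> K" and K0: "\<forall>i<N. \<forall>t. \<bar>if t \<in> {0..T} then y i t else 0\<bar> \<le> K" by blast
    have K: "\<bar>y i t\<bar> \<le> K" if "i < N" "0 \<le> t" "t \<le> T" for i t
      using K0[rule_format, OF that(1), of t] that by simp
    have iter: "\<bar>y i t\<bar> \<le> \<xi> i * max E (\<theta> ^ n * max E (inv_weight_sum * K))"
      if "i < N" "-r \<le> t" "t \<le> T" for i t n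
      using that
    proof (induction n arbitrary: i t)
      case 0
      have "\<bar>y i t\<bar> \<le> \<xi> i * max E (inv_weight_sum * K)"
      proof (cases "t \<le> 0")
        case True
        show ?thesis
          by (rule order_trans[OF hist_y[OF 0(1,2) True] mult_left_mono]) (use \<xi>_pos[OF 0(1)] in auto)
      next
        case False
        then have "\<bar>y i t\<bar> \<le> K" using K 0 by simp
        also have "\<dots> \<le> \<xi> i * (inv_weight_sum * K)" by (rule le_weight_inv_sum[OF 0(1) \<open>0 \<le> K\<close>])
        also have "\<dots> \<le> \<xi> i * max E (inv_weight_sum * K)" using \<xi>_pos[OF 0(1)] by simp
        finally show ?thesis .
      qed
      then show ?case by simp
    next
      case (Suc n)
      have "\<bar>y i t\<bar> \<le> \<xi> i * max E (\<theta> * max E (\<theta> ^ n * max E (inv_weight_sum * K)))"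
        by (rule improve[OF Suc.IH Suc.prems])
      also have "\<theta> * max E (\<theta> ^ n * max E (inv_weight_sum * K)) = max (\<theta> * E) (\<theta> ^ Suc n * max E (inv_weight_sum * K))"
        using \<mu>(2) by (simp add: max_mult_distrib_left mult.assoc)
      also have "max E \<dots> = max E (\<theta> ^ Suc n * max E (inv_weight_sum * K))"
      proof -
        have "\<theta> * E \<le> 1 * E" using \<mu>(2,3) \<open>0 \<le> E\<close> by (intro mult_right_mono) auto
        then show ?thesis by auto
      qed
      finally show ?case .
    qed
    have "\<bar>y i T\<bar> \<le> \<xi> i * E"
    proof (rule tendsto_lowerbound)
      have "(\<lambda>n. \<xi> i * max E (\<theta> ^ n * max E (inv_weight_sum * K))) \<longlonglongrightarrow> \<xi> i * max E (0 * max E (inv_weight_sum * K))"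
        using \<mu>(2,3) by (intro tendsto_intros tendsto_max LIMSEQ_realpow_zero) auto
      then show "(\<lambda>n. \<xi> i * max E (\<theta> ^ n * max E (inv_weight_sum * K))) \<longlonglongrightarrow> \<xi> i * E"
        using \<open>0 \<le> E\<close> by (simp add: max_def)
      show "\<forall>\<^sub>F n in sequentially. \<bar>y i T\<bar> \<le> \<xi> i * max E (\<theta> ^ n * max E (inv_weight_sum * K))"
        using iter[OF i, of T] T r_pos by (intro always_eventually) auto
    qed simp
    also have "\<dots> \<le> \<rho> * D"
      unfolding E_def mult.assoc[symmetric] by (intro mult_right_mono \<rho>_ge i \<open>0 \<le> D\<close>)
    finally have "exp (- \<mu> * T) * \<bar>y i T\<bar> \<le> exp (- \<mu> * T) * (\<rho> * D)" by (intro mult_left_mono) auto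
    moreover have "\<bar>u i T - v i T\<bar> = exp (- \<mu> * T) * \<bar>y i T\<bar>" by (simp add: y_def abs_mult exp_minus)
    ultimately show ?thesis by (simp add: mult_ac)
  qed
  show thesis
    by (rule that[OF \<open>1 \<le> \<rho>\<close> \<mu>(1)]) (rule main)
qed

text \<open>If the error is controlled by the solution itself with factor \<open>\<theta>\<close>
  plus a source \<open>E\<close>, a weighted bound \<open>D\<close> improves to
  \<open>\<theta> * D + E\<close>. Repeating this from any crude bound converges to the fixed point
  \<open>E / (1 - \<theta>)\<close>. The case \<open>E = 0\<close> gives uniqueness; a source
  proportional to \<open>\<eta>\<close> gives almost periodicity.\<close>

lemma entire_weighted_bound:
  assumes \<theta>: "0 \<le> \<theta>" "\<theta> < 1"
    and dw: "\<And>i t. i < N \<Longrightarrow> (w i has_real_derivative - c i t * w i t + e i t) (at t)"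
    and bd: "\<And>i. i < N \<Longrightarrow> bounded (range (w i))" and "0 \<le> E"
    and e: "\<And>D i t. 0 \<le> D \<Longrightarrow> (\<And>j t. j < N \<Longrightarrow> \<bar>w j t\<bar> \<le> \<xi> j * D) \<Longrightarrow> i < N \<Longrightarrow>
        \<bar>e i t\<bar> \<le> c0 i * (\<xi> i * (\<theta> * D + E))"
    and i: "i < N"
  shows "\<bar>w i t\<bar> \<le> \<xi> i * (E / (1 - \<theta>))"
proof -
  have "\<exists>K. \<forall>t. \<bar>w i t\<bar> \<le> K" if "i < N" for i
    using bd[OF that] by (auto simp: bounded_iff)
  from uniform_bound_lessThan[of N w, OF this]
  obtain W where W: "0 \<le> W" "\<And>i t. i < N \<Longrightarrow> \<bar>w i t\<bar> \<le> W" by blast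
  define Z where "Z n = \<theta> ^ n * (inv_weight_sum * W) + E / (1 - \<theta>)" for n :: nat
  have Z0: "0 \<le> Z n" for n
    unfolding Z_def using \<theta> \<open>0 \<le> E\<close> W(1) inv_weight_sum_nonneg by auto
  have ZS: "\<theta> * Z n + E = Z (Suc n)" for n
  proof -
    have "\<theta> * (E / (1 - \<theta>)) + E = E / (1 - \<theta>)" using \<theta>(2) by (simp add: field_simps)
    then show ?thesis unfolding Z_def by (simp add: algebra_simps)
  qed
  have iter: "\<bar>w i t\<bar> \<le> \<xi> i * Z n" if "i < N" for i t n
    using that
  proof (induction n arbitrary: i t)
    case 0
    have "\<bar>w i t\<bar> \<le> W" by (rule W(2)[OF 0])
    also have "\<dots> \<le> \<xi> i * (inv_weight_sum * W)" by (rule le_weight_inv_sum[OF 0 W(1)])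
    also have "\<dots> \<le> \<xi> i * Z 0" unfolding Z_def using \<xi>_pos[OF 0] \<theta>(2) \<open>0 \<le> E\<close> by simp
    finally show ?case .
  next
    case (Suc n)
    show ?case
    proof (rule linear_bounded_abs_le[where w="w i" and f="e i", OF c_cont[OF Suc.prems] c_ge[OF Suc.prems] c0_pos[OF Suc.prems]])
      show "\<bar>e i x\<bar> \<le> c0 i * (\<xi> i * Z (Suc n))" for x
        using e[OF Z0 Suc.IH Suc.prems] by (simp add: ZS)
      show "0 \<le> \<xi> i * Z (Suc n)" using \<xi>_pos[OF Suc.prems] Z0 by simp
    qed (use dw Suc.prems W in auto)
  qed
  show ?thesis
  proof (rule tendsto_lowerbound)
    have "(\<lambda>n. \<xi> i * Z n) \<longlonglongrightarrow> \<xi> i * (0 * (inv_weight_sum * W) + E / (1 - \<theta>))"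
      unfolding Z_def using \<theta> by (intro tendsto_intros LIMSEQ_realpow_zero) auto
    then show "(\<lambda>n. \<xi> i * Z n) \<longlonglongrightarrow> \<xi> i * (E / (1 - \<theta>))" by simp
  qed (use iter[OF i] in auto)
qed

lemma entire_solution_unique:
  assumes u: "\<And>i t. i < N \<Longrightarrow> (u i has_real_derivative - c i t * u i t + input u i t) (at t)"
      "\<And>i t. i < N \<Longrightarrow> in_region i (u i t)" "\<And>i. i < N \<Longrightarrow> bounded (range (u i))"
    and v: "\<And>i t. i < N \<Longrightarrow> (v i has_real_derivative - c i t * v i t + input v i t) (at t)"
      "\<And>i t. i < N \<Longrightarrow> in_region i (v i t)" "\<And>i. i < N \<Longrightarrow> bounded (range (v i))"
    and i: "i < N"
  shows "u i t = v i t"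
proof -
  obtain \<theta> where \<theta>: "0 \<le> \<theta>" "\<theta> < 1" "\<And>i. i < N \<Longrightarrow> row_sum i \<le> \<theta> * (c0 i * \<xi> i)"
    using contraction_constant by blast
  have "\<bar>u i t - v i t\<bar> \<le> \<xi> i * (0 / (1 - \<theta>))"
  proof (rule entire_weighted_bound[where w="\<lambda>i t. u i t - v i t" and e="\<lambda>i t. input u i t - input v i t", OF \<theta>(1,2)])
    fix i t assume i: "i < N"
    show "((\<lambda>t. u i t - v i t) has_real_derivative - c i t * (u i t - v i t) + (input u i t - input v i t)) (at t)"
      using DERIV_diff[OF u(1)[OF i, of t] v(1)[OF i, of t]] by (simp add: algebra_simps)
  next
    fix i assume "i < N"
    then show "bounded (range (\<lambda>t. u i t - v i t))"
      using u(3) v(3) by (intro bounded_minus_comp) auto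
  next
    fix D i t assume D: "0 \<le> D" "\<And>j t. j < N \<Longrightarrow> \<bar>u j t - v j t\<bar> \<le> \<xi> j * D" and i: "i < N"
    have "\<bar>input u i t - input v i t\<bar> \<le> row_sum i * D"
      by (rule input_diff_le[OF i]) (use u(2) v(2) D(2) in auto)
    also have "\<dots> \<le> \<theta> * (c0 i * \<xi> i) * D" by (intro mult_right_mono \<theta>(3) i D(1))
    finally show "\<bar>input u i t - input v i t\<bar> \<le> c0 i * (\<xi> i * (\<theta> * D + 0))" by (simp add: mult_ac)
  qed (use i in auto)
  then show ?thesis by simp
qed

lemma entire_solution_almost_periodic:
  assumes c_ap: "\<And>i. i < N \<Longrightarrow> almost_periodic (c i)"
    and J_ap: "\<And>i. i < N \<Longrightarrow> almost_periodic (J i)"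
    and a_ap: "\<And>i j l. i < N \<Longrightarrow> j < N \<Longrightarrow> l < M \<Longrightarrow> almost_periodic (a i j l)"
    and \<kappa>_ap: "\<And>i j l. i < N \<Longrightarrow> j < N \<Longrightarrow> l < M \<Longrightarrow> almost_periodic (\<kappa> i j l)"
    and du: "\<And>i t. i < N \<Longrightarrow> (u i has_real_derivative - c i t * u i t + input u i t) (at t)"
    and reg: "\<And>i t. i < N \<Longrightarrow> in_region i (u i t)"
    and bd: "\<And>i. i < N \<Longrightarrow> bounded (range (u i))"
    and i0: "i0 < N"
  shows "almost_periodic (u i0)"
proof -
  obtain \<theta> where \<theta>: "0 \<le> \<theta>" "\<theta> < 1" "\<And>i. i < N \<Longrightarrow> row_sum i \<le> \<theta> * (c0 i * \<xi> i)"
    using contraction_constant by blast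
  have "\<exists>K. \<forall>t. \<bar>u i t\<bar> \<le> K" if "i < N" for i
    using bd[OF that] by (auto simp: bounded_iff)
  from uniform_bound_lessThan[of N u, OF this]
  obtain U where U: "0 \<le> U" "\<And>i t. i < N \<Longrightarrow> \<bar>u i t\<bar> \<le> U" by blast
  have "\<exists>K. \<forall>t. \<bar>- c i t * u i t + input u i t\<bar> \<le> K" if i: "i < N" for i
  proof -
    obtain K1 where K1: "\<And>t. \<bar>c i t\<bar> \<le> K1" using almost_periodic_bounded[OF c_ap[OF i]] by blast
    obtain K2 where K2: "\<And>t. \<bar>input u i t\<bar> \<le> K2" using input_bounded[OF i] by blast
    have "\<bar>- c i t * u i t + input u i t\<bar> \<le> K1 * U + K2" for t
    proof -
      have "\<bar>c i t * u i t\<bar> \<le> K1 * U"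
        unfolding abs_mult using K1[of t] U(2)[OF i, of t] by (intro mult_mono) auto
      then show ?thesis using K2[of t] by (simp add: abs_le_iff)
    qed
    then show ?thesis by blast
  qed
  from uniform_bound_lessThan[of N "\<lambda>i t. - c i t * u i t + input u i t", OF this]
  obtain \<Lambda> where \<Lambda>: "0 \<le> \<Lambda>" "\<And>i t. i < N \<Longrightarrow> \<bar>- c i t * u i t + input u i t\<bar> \<le> \<Lambda>" by blast
  have lip: "\<bar>u i x - u i y\<bar> \<le> \<Lambda> * \<bar>x - y\<bar>" if "i < N" for i x y
    using field_differentiable_bound[OF convex_UNIV du[OF that], of \<Lambda> x y] \<Lambda>(2)[OF that] by simp
  define Bsum where "Bsum = (\<Sum>l<M. \<Sum>j<N. B j)"
  \<comment> \<open>The total error per unit of \<open>\<eta>\<close>: the first term comes from the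
    delays, \<open>U\<close> from \<open>c\<close>, \<open>Bsum\<close> from \<open>a\<close>, and 1
    from \<open>J\<close>. Below, \<open>Q\<close> is chosen so that \<open>k i\<close> fits the
    form \<open>c0 i * \<xi> i * Q\<close> asked for by
    \<open>entire_weighted_bound\<close>.\<close>
  define k where "k i = row_sum i * (\<Lambda> * inv_weight_sum) + U + Bsum + 1" for i
  have B0: "0 \<le> B j" if "j < N" for j using G_bound[OF that, of 0] by linarith
  have Bsum: "0 \<le> Bsum" unfolding Bsum_def by (intro sum_nonneg) (simp add: B0)
  have k0: "0 \<le> k i" if "i < N" for i
    unfolding k_def using row_sum_nonneg[OF that] \<Lambda>(1) U(1) Bsum inv_weight_sum_nonneg by auto
  define Q where "Q = (\<Sum>i<N. k i / (c0 i * \<xi> i))"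
  have Q: "k i \<le> c0 i * \<xi> i * Q" if "i < N" for i
  proof -
    have "k i / (c0 i * \<xi> i) \<le> Q"
      unfolding Q_def using that k0 c0_pos \<xi>_pos by (intro member_le_sum) (auto simp: less_imp_le)
    then show ?thesis using c0_pos[OF that] \<xi>_pos[OF that] by (simp add: pos_divide_le_eq mult.commute)
  qed
  have Q0: "0 \<le> Q"
    unfolding Q_def using k0 c0_pos \<xi>_pos by (intro sum_nonneg) (auto simp: less_imp_le)
  define I where "I = c ` {..<N} \<union> J ` {..<N} \<union> (\<lambda>(i, j, l). a i j l) ` ({..<N} \<times> {..<N} \<times> {..<M}) \<union>
    (\<lambda>(i, j, l). \<kappa> i j l) ` ({..<N} \<times> {..<N} \<times> {..<M})"
  have "finite I" by (auto simp: I_def)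
  have I_ap: "almost_periodic f" if "f \<in> I" for f
    using that c_ap J_ap a_ap \<kappa>_ap by (auto simp: I_def)
  \<comment> \<open>The translate of \<open>u\<close> solves the network with translated
    coefficients. Its equation is rewritten with the untranslated damping \<open>c i t\<close>; the
    discrepancy, times \<open>u i (t + T)\<close>, joins the change of input in the error
    term.\<close>
  have key: "\<bar>u i (t + T) - u i t\<bar> \<le> \<xi> i * (\<eta> * Q / (1 - \<theta>))"
    if "0 \<le> \<eta>" and per: "\<And>f t. f \<in> I \<Longrightarrow> \<bar>f (t + T) - f t\<bar> \<le> \<eta>" and i: "i < N" for \<eta> T i t
  proof (rule entire_weighted_bound[where w="\<lambda>i t. u i (t + T) - u i t"
        and e="\<lambda>i t. - (c i (t + T) - c i t) * u i (t + T) + (input u i (t + T) - input u i t)", OF \<theta>(1,2)])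
    fix i t assume i: "i < N"
    have "((\<lambda>t. u i (t + T)) has_real_derivative - c i (t + T) * u i (t + T) + input u i (t + T)) (at t)"
      using du[OF i, of "t + T"] by (simp add: DERIV_shift)
    from DERIV_diff[OF this du[OF i, of t]]
    show "((\<lambda>t. u i (t + T) - u i t) has_real_derivative - c i t * (u i (t + T) - u i t) +
        (- (c i (t + T) - c i t) * u i (t + T) + (input u i (t + T) - input u i t))) (at t)"
      by (simp add: algebra_simps)
  next
    fix i assume i: "i < N"
    show "bounded (range (\<lambda>t. u i (t + T) - u i t))"
      by (rule bounded_minus_comp) (use bd[OF i] in \<open>auto intro: bounded_subset\<close>)
  next
    show "0 \<le> \<eta> * Q" using that(1) Q0 by simp
  next
    fix D i t assume D: "0 \<le> D" "\<And>j t. j < N \<Longrightarrow> \<bar>u j (t + T) - u j t\<bar> \<le> \<xi> j * D" and i: "i < N"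
    define y where "y j l = G j (u j (t + T - \<kappa> i j l (t + T)))" for j l
    define z where "z j l = G j (u j (t - \<kappa> i j l t))" for j l
    have "\<bar>(\<Sum>l<M. \<Sum>j<N. a i j l t * y j l) - (\<Sum>l<M. \<Sum>j<N. a i j l t * z j l)\<bar>
        \<le> row_sum i * (D + \<Lambda> * inv_weight_sum * \<eta>)"
    proof (rule coupling_diff_le[OF i])
      fix j l assume jl: "j < N" "l < M"
      \<comment> \<open>The two changes are separated: here the delay changes by at most
        \<open>\<eta>\<close>, which costs \<open>\<Lambda> * \<eta>\<close>; the translation by
        \<open>T\<close> at the point \<open>t - \<kappa> i j l t\<close> then costs
        \<open>\<xi> j * D\<close>.\<close>
      have "\<bar>u j (t + T - \<kappa> i j l (t + T)) - u j (t - \<kappa> i j l t + T)\<bar> \<le> \<Lambda> * \<eta>"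
      proof (rule order_trans[OF lip[OF jl(1)]])
        have "\<kappa> i j l \<in> I" using i jl unfolding I_def by force
        from per[OF this, of t] have "\<bar>\<kappa> i j l t - \<kappa> i j l (t + T)\<bar> \<le> \<eta>" by linarith
        then show "\<Lambda> * \<bar>t + T - \<kappa> i j l (t + T) - (t - \<kappa> i j l t + T)\<bar> \<le> \<Lambda> * \<eta>"
          using \<Lambda>(1) by (intro mult_left_mono) auto
      qed
      also have "\<dots> \<le> \<xi> j * (inv_weight_sum * (\<Lambda> * \<eta>))"
        by (rule le_weight_inv_sum[OF jl(1)]) (use \<Lambda>(1) that(1) in simp)
      finally have "\<bar>u j (t + T - \<kappa> i j l (t + T)) - u j (t - \<kappa> i j l t)\<bar>
          \<le> \<xi> j * (inv_weight_sum * (\<Lambda> * \<eta>)) + \<xi> j * D"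
        using D(2)[OF jl(1), of "t - \<kappa> i j l t"] by linarith
      also have "\<dots> = \<xi> j * (D + \<Lambda> * inv_weight_sum * \<eta>)" by (simp add: algebra_simps)
      finally have le: "\<bar>u j (t + T - \<kappa> i j l (t + T)) - u j (t - \<kappa> i j l t)\<bar> \<le> \<xi> j * (D + \<Lambda> * inv_weight_sum * \<eta>)" .
      have "\<bar>y j l - z j l\<bar> \<le> L j * \<bar>u j (t + T - \<kappa> i j l (t + T)) - u j (t - \<kappa> i j l t)\<bar>"
        unfolding y_def z_def using reg[OF jl(1)] by (intro G_lip[OF jl(1)]) (auto simp: in_region_def)
      also have "\<dots> \<le> L j * (\<xi> j * (D + \<Lambda> * inv_weight_sum * \<eta>))"
        by (intro mult_left_mono le L_nonneg jl)
      finally show "\<bar>y j l - z j l\<bar> \<le> L j * (\<xi> j * (D + \<Lambda> * inv_weight_sum * \<eta>))" .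
    qed
    moreover have "\<bar>(\<Sum>l<M. \<Sum>j<N. a i j l (t + T) * y j l) - (\<Sum>l<M. \<Sum>j<N. a i j l t * y j l)\<bar> \<le> \<eta> * Bsum"
    proof -
      have "(\<Sum>l<M. \<Sum>j<N. a i j l (t + T) * y j l) - (\<Sum>l<M. \<Sum>j<N. a i j l t * y j l)
          = (\<Sum>l<M. \<Sum>j<N. (a i j l (t + T) - a i j l t) * y j l)"
        by (simp add: sum_subtractf left_diff_distrib)
      moreover have "\<bar>\<dots>\<bar> \<le> (\<Sum>l<M. \<Sum>j<N. \<eta> * B j)"
      proof (intro sum_abs[THEN order_trans] sum_mono)
        fix l j assume "l \<in> {..<M}" "j \<in> {..<N}"
        then have jl: "j < N" "l < M" by auto
        have "a i j l \<in> I" using i jl unfolding I_def by force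
        from per[OF this, of t] show "\<bar>(a i j l (t + T) - a i j l t) * y j l\<bar> \<le> \<eta> * B j"
          unfolding abs_mult y_def by (intro mult_mono G_bound jl that(1)) auto
      qed
      moreover have "\<dots> = \<eta> * Bsum" by (simp add: Bsum_def sum_distrib_left mult_ac)
      ultimately show ?thesis by simp
    qed
    moreover have "\<bar>J i (t + T) - J i t\<bar> \<le> \<eta>" by (rule per) (use i in \<open>auto simp: I_def\<close>)
    moreover have "\<bar>(c i (t + T) - c i t) * u i (t + T)\<bar> \<le> \<eta> * U"
      unfolding abs_mult by (intro mult_mono per U i that(1)) (use i in \<open>auto simp: I_def\<close>)
    ultimately have "\<bar>- (c i (t + T) - c i t) * u i (t + T) + (input u i (t + T) - input u i t)\<bar>
        \<le> row_sum i * (D + \<Lambda> * inv_weight_sum * \<eta>) + \<eta> * Bsum + \<eta> + \<eta> * U"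
      unfolding input_def y_def z_def minus_mult_left[symmetric] by linarith
    also have "\<dots> = row_sum i * D + \<eta> * k i" by (simp add: k_def algebra_simps)
    also have "\<dots> \<le> \<theta> * (c0 i * \<xi> i) * D + \<eta> * (c0 i * \<xi> i * Q)"
      by (intro add_mono mult_right_mono mult_left_mono \<theta>(3) Q i D(1) that(1))
    also have "\<dots> = c0 i * (\<xi> i * (\<theta> * D + \<eta> * Q))" by (simp add: algebra_simps)
    finally show "\<bar>- (c i (t + T) - c i t) * u i (t + T) + (input u i (t + T) - input u i t)\<bar>
        \<le> c0 i * (\<xi> i * (\<theta> * D + \<eta> * Q))" .
  qed (rule i)
  show ?thesis
    unfolding almost_periodic_def
  proof (intro conjI allI impI)
    show "continuous_on UNIV (u i0)" by (rule DERIV_continuous_on) (rule du[OF i0, THEN DERIV_subset], simp)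
    fix \<epsilon> :: real assume "\<epsilon> > 0"
    define q where "q = \<xi> i0 * Q / (1 - \<theta>)"
    have "0 \<le> q" unfolding q_def using \<xi>_pos[OF i0] Q0 \<theta>(2) by simp
    define \<eta> where "\<eta> = \<epsilon> / (q + 1)"
    have "\<eta> > 0" using \<open>\<epsilon> > 0\<close> \<open>0 \<le> q\<close> by (simp add: \<eta>_def)
    have "\<eta> * (q + 1) = \<epsilon>" using \<open>0 \<le> q\<close> by (simp add: \<eta>_def)
    then have "\<eta> * q < \<epsilon>" using \<open>\<eta> > 0\<close> by (simp add: algebra_simps)
    have "relatively_dense {T. \<forall>f\<in>I. \<forall>t. \<bar>f (t + T) - f t\<bar> < \<eta>}"
      using almost_periodic_common_periods[of I "\<lambda>f. f", OF \<open>finite I\<close> I_ap \<open>\<eta> > 0\<close>] .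
    then show "relatively_dense {T. \<forall>t. \<bar>u i0 (t + T) - u i0 t\<bar> < \<epsilon>}"
    proof (rule relatively_dense_superset, intro subsetI CollectI allI)
      fix T t assume T: "T \<in> {T. \<forall>f\<in>I. \<forall>t. \<bar>f (t + T) - f t\<bar> < \<eta>}"
      have "\<bar>u i0 (t + T) - u i0 t\<bar> \<le> \<xi> i0 * (\<eta> * Q / (1 - \<theta>))"
        by (rule key[OF _ _ i0]) (use T \<open>\<eta> > 0\<close> in \<open>auto simp: less_imp_le\<close>)
      also have "\<dots> = \<eta> * q" by (simp add: q_def)
      finally show "\<bar>u i0 (t + T) - u i0 t\<bar> < \<epsilon>" using \<open>\<eta> * q < \<epsilon>\<close> by linarith
    qed
  qed
qed

end

text \<open>For uniqueness, a competitor is bounded because it is almost periodic, and lies in the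
  region because its segments do at argument 0; \<open>entire_solution_unique\<close> then applies.
  The equations for \<open>X\<close> and \<open>K\<close> are the interface to the concrete
  right-hand side and basin.\<close>

lemma (in delay_network) unique_stable_ap_solution:
  assumes "N \<ge> 1"
    and ap: "\<And>i. i < N \<Longrightarrow> almost_periodic (c i)" "\<And>i. i < N \<Longrightarrow> almost_periodic (J i)"
      "\<And>i j l. i < N \<Longrightarrow> j < N \<Longrightarrow> l < M \<Longrightarrow> almost_periodic (a i j l)"
      "\<And>i j l. i < N \<Longrightarrow> j < N \<Longrightarrow> l < M \<Longrightarrow> almost_periodic (\<kappa> i j l)"
    and X: "\<And>u i t. X u i t = - c i t * u i t + input u i t"
    and K: "K = {\<phi>. \<forall>i<N. continuous_on {-r..0} (\<phi> i) \<and> (\<forall>x\<in>{-r..0}. in_region i (\<phi> i x))}"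
  shows "\<exists>u. stable_ap_solution N X r K u \<and>
    (\<forall>v. stable_ap_solution N X r K v \<longrightarrow> (\<forall>i<N. \<forall>t. v i t = u i t))"
proof -
  obtain u where u: "\<And>i. i < N \<Longrightarrow> bounded (range (u i))" "\<And>i t. i < N \<Longrightarrow> in_region i (u i t)"
    "\<And>i t. i < N \<Longrightarrow> (u i has_real_derivative - c i t * u i t + input u i t) (at t)"
    using entire_solution_exists by blast
  have u_cont: "continuous_on S (u i)" if "i < N" for i S
    by (rule DERIV_continuous_on[OF DERIV_subset[OF u(3)[OF that]]]) simp
  have u_ap: "almost_periodic (u i)" if "i < N" for i
    by (rule entire_solution_almost_periodic[OF ap u(3,2,1) that])
  have seg: "segment u t \<in> K" for t
    unfolding K segment_def using u(2)
    by (auto intro!: continuous_on_compose2[OF u_cont[of _ UNIV]] continuous_intros)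
  from exponential_decay[OF \<open>N \<ge> 1\<close>] have stable: "exponentially_stable_in N X r K u"
  proof cases
    case decay: (1 \<rho> \<mu>)
    show ?thesis
      unfolding exponentially_stable_in_def
    proof (rule conjI[OF allI[OF seg]], rule exI[of _ \<rho>], rule conjI[OF decay(1)],
        rule exI[of _ \<mu>], rule conjI[OF decay(2)], rule ballI, rule conjI)
      fix \<phi> assume "\<phi> \<in> K"
      then have \<phi>: "\<And>i. i < N \<Longrightarrow> continuous_on {-r..0} (\<phi> i)"
        "\<And>i x. i < N \<Longrightarrow> -r \<le> x \<Longrightarrow> x \<le> 0 \<Longrightarrow> in_region i (\<phi> i x)" by (auto simp: K)
      show "\<exists>v. ivp_solution N X r \<phi> v"
        using ivp_solution_exists[OF \<phi>] unfolding ivp_solution_def X .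
      define D where "D = hist_norm N r (\<lambda>i s. segment u 0 i s - \<phi> i s)"
      have hist: "\<bar>u i t - \<phi> i t\<bar> \<le> D" if i: "i < N" and t: "t \<in> {-r..0}" for i t
      proof -
        have "continuous_on {-r..0} (\<lambda>s. \<bar>u i (0 + s) - \<phi> i s\<bar>)"
          by (auto intro!: continuous_intros \<phi>(1) u_cont i)
        then have "bounded ((\<lambda>s. \<bar>u i (0 + s) - \<phi> i s\<bar>) ` {-r..0})"
          by (intro compact_imp_bounded compact_continuous_image) auto
        then have "\<bar>u i (0 + t) - \<phi> i t\<bar> \<le> (SUP s\<in>{-r..0}. \<bar>u i (0 + s) - \<phi> i s\<bar>)"
          by (intro cSUP_upper t bounded_imp_bdd_above)
        also have "\<dots> \<le> D"
          unfolding D_def hist_norm_def segment_def using i by (intro Max_ge) auto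
        finally show ?thesis by simp
      qed
      show "\<forall>v. ivp_solution N X r \<phi> v \<longrightarrow> (\<forall>t\<ge>0. Max ((\<lambda>i. \<bar>u i t - v i t\<bar>) ` {..<N})
        \<le> \<rho> * exp (- \<mu> * t) * hist_norm N r (\<lambda>i s. segment u 0 i s - \<phi> i s))"
      proof (intro allI impI)
        fix v and t :: real assume v: "ivp_solution N X r \<phi> v" and t: "0 \<le> t"
        have v\<phi>: "v i x = \<phi> i x" if "i < N" "x \<in> {-r..0}" for i x
          using v that by (simp add: ivp_solution_def)
        have dv: "(v i has_real_derivative - c i t * v i t + input v i t) (at t within {0..})"
          if "i < N" "0 \<le> t" for i t using v that by (simp add: ivp_solution_def X)
        have v_reg: "in_region i (v i t)" if "i < N" "-r \<le> t" for i t
          by (rule ivp_in_region[OF _ dv that]) (use v\<phi> \<phi>(2) in auto)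
        have "\<bar>u i t - v i t\<bar> \<le> \<rho> * exp (- \<mu> * t) * D" if i: "i < N" for i
        proof (rule decay(3)[OF DERIV_subset[OF u(3)] dv _ _ i t])
          fix i t assume "i < N" "-r \<le> t" "t \<le> 0"
          then show "\<bar>u i t - v i t\<bar> \<le> D" using hist v\<phi> by simp
        qed (use u(2) v_reg in auto)
        then show "Max ((\<lambda>i. \<bar>u i t - v i t\<bar>) ` {..<N})
          \<le> \<rho> * exp (- \<mu> * t) * hist_norm N r (\<lambda>i s. segment u 0 i s - \<phi> i s)"
          unfolding D_def using \<open>N \<ge> 1\<close> by (subst Max_le_iff) (auto simp: lessThan_empty_iff)
      qed
    qed
  qed
  have uniq: "v i t = u i t" if v: "stable_ap_solution N X r K v" and i: "i < N" for v i t
  proof (rule entire_solution_unique[OF _ _ _ u(3,2,1) i])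
    fix i assume i: "i < N"
    show "(v i has_real_derivative - c i t * v i t + input v i t) (at t)" for t
      using v i by (simp add: stable_ap_solution_def entire_solution_def X)
    show "in_region i (v i t)" for t
    proof -
      have "segment v t \<in> K" using v by (simp add: stable_ap_solution_def exponentially_stable_in_def)
      then have "in_region i (segment v t i 0)" using i r_pos by (simp add: K)
      then show ?thesis by (simp add: segment_def)
    qed
    show "bounded (range (v i))"
      using almost_periodic_bounded[of "v i"] v i by (auto simp: stable_ap_solution_def bounded_iff)
  qed
  show ?thesis
    using stable u_ap u(3) uniq
    by (intro exI[of _ u]) (auto simp: stable_ap_solution_def entire_solution_def X)
qed

section \<open>Activation functions and the main theorem\<close>

lemma class_A_mono:
  assumes "class_A f b" "x \<le> y"
  shows "f x \<le> f y"
proof (rule DERIV_nonneg_imp_nondecreasing[OF \<open>x \<le> y\<close>])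
  fix z
  have "(f has_real_derivative deriv f z) (at z)" "deriv f z > 0"
    using assms(1) by (auto simp: class_A_def C2_fun_def DERIV_deriv_iff_real_differentiable)
  then show "\<exists>d. (f has_real_derivative d) (at z) \<and> 0 \<le> d" by (auto intro: less_imp_le)
qed

text \<open>The slope falls off in both directions away from 0. As \<open>0 < s * q\<close> keeps
  the half-line from \<open>q\<close> outwards on one side of 0, the slope is largest at
  \<open>q\<close>, and the mean value inequality applies on this convex set.\<close>

lemma class_A_lipschitz_tail:
  fixes s q :: real
  assumes f: "class_A f b" and s: "s = 1 \<or> s = -1" and q: "0 < s * q"
    and x: "s * q \<le> s * x" and y: "s * q \<le> s * y"
  shows "\<bar>f x - f y\<bar> \<le> deriv f q * \<bar>x - y\<bar>"
proof -
  have df: "(f has_real_derivative deriv f z) (at z)" for z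
    using f by (simp add: class_A_def C2_fun_def DERIV_deriv_iff_real_differentiable)
  have ddf: "(deriv f has_real_derivative deriv (deriv f) z) (at z)" for z
    using f by (simp add: class_A_def C2_fun_def DERIV_deriv_iff_real_differentiable)
  have sgn: "z * deriv (deriv f) z < 0" if "z \<noteq> 0" for z using f that by (simp add: class_A_def)
  have pos: "deriv f z > 0" for z using f by (simp add: class_A_def)
  have le: "deriv f z \<le> deriv f q" if "s * q \<le> s * z" for z
    using s
  proof
    assume s1: "s = 1"
    then have "q \<le> z" using that by simp
    then show ?thesis
    proof (rule DERIV_nonpos_imp_nonincreasing)
      fix w assume "q \<le> w"
      then have "0 < w" using q s1 by simp
      then have "deriv (deriv f) w < 0" using sgn[of w] by (simp add: mult_less_0_iff)
      then show "\<exists>d. (deriv f has_real_derivative d) (at w) \<and> d \<le> 0" using ddf[of w] by (auto intro: less_imp_le)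
    qed
  next
    assume s1: "s = -1"
    then have "z \<le> q" using that by simp
    then show ?thesis
    proof (rule DERIV_nonneg_imp_nondecreasing)
      fix w assume "w \<le> q"
      then have "w < 0" using q s1 by simp
      then have "0 < deriv (deriv f) w" using sgn[of w] by (simp add: mult_less_0_iff)
      then show "\<exists>d. (deriv f has_real_derivative d) (at w) \<and> 0 \<le> d" using ddf[of w] by (auto intro: less_imp_le)
    qed
  qed
  have conv: "convex {z. s * q \<le> s * z}"
  proof -
    have "{z. s * q \<le> s * z} = (if s = 1 then {q..} else {..q})" using s by auto
    then show ?thesis by (auto simp: convex_real_interval)
  qed
  have "norm (f x - f y) \<le> deriv f q * norm (x - y)"
    by (rule field_differentiable_bound[OF conv DERIV_subset[OF df]]) (use le pos x y in \<open>auto simp: less_imp_le\<close>)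
  then show ?thesis by simp
qed

lemma finite_delay_set:
  "finite {\<kappa>b i j l | i j l. i < N \<and> j < N \<and> l < (M::nat)}" for N :: nat
proof -
  have "{\<kappa>b i j l | i j l. i < N \<and> j < N \<and> l < M}
      = (\<lambda>(i, j, l). \<kappa>b i j l) ` ({..<N} \<times> {..<N} \<times> {..<M})" by force
  then show ?thesis by simp
qed

lemma le_max_delay: "i < N \<Longrightarrow> j < N \<Longrightarrow> l < M \<Longrightarrow> \<kappa>b i j l \<le> max_delay N M \<kappa>b"
  unfolding max_delay_def by (rule Max_ge[OF finite_delay_set]) blast

lemma H3A_entry:
  assumes "i < N" "j < N"
  shows "(C_mat N c - H_mat N M a * G_mat N \<sigma> g \<beta> \<alpha>) $$ (i, j) =
    (if i = j then INF t. c i t else 0) - (\<Sum>l<M. SUP t. \<bar>a i j l t\<bar>) *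
      (\<sigma> j * max (deriv (g j) (\<sigma> j * \<beta> j)) (deriv (g j) (\<sigma> j * \<alpha> j)))"
proof -
  have H: "H_mat N M a \<in> carrier_mat N N" by (simp add: H_mat_def)
  show ?thesis
    unfolding G_mat_def mat_diag_mult_right[OF H]
    using assms by (simp add: C_mat_def H_mat_def mat_diag_def)
qed

theorem theorem3:
  fixes N M :: nat
    and c :: "nat \<Rightarrow> real \<Rightarrow> real"
    and a \<kappa> :: "nat \<Rightarrow> nat \<Rightarrow> nat \<Rightarrow> real \<Rightarrow> real"
    and \<kappa>b :: "nat \<Rightarrow> nat \<Rightarrow> nat \<Rightarrow> real"
    and \<sigma> B \<beta> \<alpha> :: "nat \<Rightarrow> real"
    and g J :: "nat \<Rightarrow> real \<Rightarrow> real"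
    and z :: "nat \<Rightarrow> nat \<Rightarrow> real"
    and sel :: "nat \<Rightarrow> nat"
  assumes "N \<ge> 1" and "M \<ge> 1"
    and delay_bounds: "\<And>i j l t. i < N \<Longrightarrow> j < N \<Longrightarrow> l < M \<Longrightarrow> 0 < \<kappa> i j l t \<and> \<kappa> i j l t \<le> \<kappa>b i j l"
    and H1_c: "\<And>i. i < N \<Longrightarrow> almost_periodic (c i) \<and> (\<forall>t. c i t > 0)"
    and H1_a: "\<And>i j l. i < N \<Longrightarrow> j < N \<Longrightarrow> l < M \<Longrightarrow> almost_periodic (a i j l)"
    and H1_kappa: "\<And>i j l. i < N \<Longrightarrow> j < N \<Longrightarrow> l < M \<Longrightarrow> almost_periodic (\<kappa> i j l)"
    and H1_J: "\<And>i. i < N \<Longrightarrow> almost_periodic (J i)"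
    and H1_sigma: "\<And>j. j < N \<Longrightarrow> \<sigma> j > 0"
    and H1_diag: "\<And>i l t. i < N \<Longrightarrow> l < M \<Longrightarrow> a i i l t > 0"
    and g_class_A: "\<And>i. i < N \<Longrightarrow> class_A (g i) (B i)"
    and H1A: "\<And>i. i < N \<Longrightarrow>
        (INF t. \<Sum>l<M. a i i l t) > 0 \<and>
        (INF x. deriv (g i) x) < (SUP t. c i t) / (\<sigma> i * (INF t. \<Sum>l<M. a i i l t)) \<and>
        (SUP t. c i t) / (\<sigma> i * (INF t. \<Sum>l<M. a i i l t)) < (SUP x. deriv (g i) x)"
    and z_zeros: "\<And>i. i < N \<Longrightarrow>
        z i 1 < 0 \<and> 0 < z i 2 \<and>
        deriv (aux_F M c a \<sigma> g i) (z i 1) = 0 \<and> deriv (aux_F M c a \<sigma> g i) (z i 2) = 0"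
    and H2A: "\<And>i k t. i < N \<Longrightarrow> k \<in> {1, 2} \<Longrightarrow>
        (- 1) ^ k * (aux_F M c a \<sigma> g i (z i k) + J i t) > coupling_bound N M a B i"
    and beta: "\<And>i. i < N \<Longrightarrow> \<beta> i < z i 1 \<and>
        aux_F M c a \<sigma> g i (\<beta> i) + coupling_bound N M a B i + (SUP t. J i t) = 0"
    and alpha: "\<And>i. i < N \<Longrightarrow> \<alpha> i > z i 2 \<and>
        aux_F M c a \<sigma> g i (\<alpha> i) - coupling_bound N M a B i + (INF t. J i t) = 0"
    and H3A: "C_mat N c - H_mat N M a * G_mat N \<sigma> g \<beta> \<alpha> \<in> class_M N"
    and sel: "\<And>i. i < N \<Longrightarrow> sel i \<in> {1, 2}"
  shows "\<exists>u. stable_ap_solution N (gnn_rhs N M c a \<kappa> \<sigma> g J) (max_delay N M \<kappa>b)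
               (basin N (max_delay N M \<kappa>b) \<beta> \<alpha> sel) u \<and>
           (\<forall>v. stable_ap_solution N (gnn_rhs N M c a \<kappa> \<sigma> g J) (max_delay N M \<kappa>b)
                  (basin N (max_delay N M \<kappa>b) \<beta> \<alpha> sel) v
                \<longrightarrow> (\<forall>i<N. \<forall>t. v i t = u i t))"
proof -
  define r where "r = max_delay N M \<kappa>b"
  define c0 where "c0 i = (INF t. c i t)" for i
  define A where "A i j l = (SUP t. \<bar>a i j l t\<bar>)" for i j l
  define \<gamma> where "\<gamma> j = max (deriv (g j) (\<sigma> j * \<beta> j)) (deriv (g j) (\<sigma> j * \<alpha> j))" for j
  define L where "L j = \<sigma> j * \<gamma> j" for j
  define s :: "nat \<Rightarrow> real" where "s j = (if sel j = 1 then -1 else 1)" for j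
  define p where "p j = (if sel j = 1 then \<beta> j else \<alpha> j)" for j
  define G where "G j x = g j (\<sigma> j * x)" for j x
  have s_sign: "s j = 1 \<or> s j = -1" for j by (simp add: s_def)
  \<comment> \<open>This is \<open>\<beta> j < z j 1 < 0\<close> or
    \<open>0 < z j 2 < \<alpha> j\<close>: the region stays on one side of 0. Both the slope bound
    and the sign arguments in \<open>inward\<close> rely on it.\<close>
  have sp: "0 < s j * p j" if "j < N" for j
    using beta[OF that] alpha[OF that] z_zeros[OF that] by (auto simp: s_def p_def)
  have bnd: "bdd_above (range f) \<and> bdd_below (range f) \<and> bdd_above (range (\<lambda>t. \<bar>f t\<bar>))"
    if "almost_periodic f" for f
  proof -
    obtain K where K: "\<And>t. \<bar>f t\<bar> \<le> K" using almost_periodic_bounded[OF \<open>almost_periodic f\<close>] by blast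
    then have "f t \<le> K" "- K \<le> f t" for t using K[of t] by linarith+
    then show ?thesis using K by (auto intro!: bdd_aboveI[of _ K] bdd_belowI[of _ "- K"])
  qed
  have cont: "continuous_on UNIV f" if "almost_periodic f" for f
    using that by (simp add: almost_periodic_def)
  have c0_le: "c0 i \<le> c i t" if "i < N" for i t
    unfolding c0_def using bnd H1_c[OF that] by (intro cINF_lower) auto
  have A_ge: "\<bar>a i j l t\<bar> \<le> A i j l" if "i < N" "j < N" "l < M" for i j l t
    unfolding A_def using bnd[OF H1_a[OF that]] by (intro cSUP_upper) auto
  have A0: "0 \<le> A i j l" if "i < N" "j < N" "l < M" for i j l
    using A_ge[OF that, of 0] by linarith
  have \<gamma>_pos: "0 < \<gamma> j" if "j < N" for j
    using g_class_A[OF that] by (simp add: \<gamma>_def class_A_def less_max_iff_disj)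
  have L_pos: "0 < L j" if "j < N" for j
    using \<gamma>_pos[OF that] H1_sigma[OF that] by (simp add: L_def)
  \<comment> \<open>Row \<open>i\<close> of the matrix applied to \<open>\<xi>\<close> is
    \<open>c0 i * \<xi> i\<close> minus the weighted coupling, so positivity of the rows is exactly
    the condition \<open>dominant\<close>.\<close>
  obtain \<xi> where \<xi>: "\<And>i. i < N \<Longrightarrow> 0 < \<xi> i"
    and row: "\<And>i. i < N \<Longrightarrow> 0 < (\<Sum>j<N. (C_mat N c - H_mat N M a * G_mat N \<sigma> g \<beta> \<alpha>) $$ (i, j) * \<xi> j)"
    using leading_minors_pos_imp_semipositive[of "C_mat N c - H_mat N M a * G_mat N \<sigma> g \<beta> \<alpha>" N] H3A
    unfolding class_M_def by auto
  have dominant: "(\<Sum>l<M. \<Sum>j<N. A i j l * (L j * \<xi> j)) < c0 i * \<xi> i" if i: "i < N" for i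
  proof -
    have "(\<Sum>j<N. (C_mat N c - H_mat N M a * G_mat N \<sigma> g \<beta> \<alpha>) $$ (i, j) * \<xi> j)
        = (\<Sum>j<N. (if i = j then c0 i * \<xi> j else 0) - (\<Sum>l<M. A i j l * (L j * \<xi> j)))"
      using i by (intro sum.cong refl)
        (auto simp: H3A_entry c0_def A_def L_def \<gamma>_def left_diff_distrib sum_distrib_right mult.assoc)
    also have "\<dots> = c0 i * \<xi> i - (\<Sum>j<N. \<Sum>l<M. A i j l * (L j * \<xi> j))"
      using i by (simp add: sum_subtractf)
    also have "(\<Sum>j<N. \<Sum>l<M. A i j l * (L j * \<xi> j)) = (\<Sum>l<M. \<Sum>j<N. A i j l * (L j * \<xi> j))"
      by (rule sum.swap)
    finally show ?thesis using row[OF i] by simp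
  qed
  \<comment> \<open>Positivity of \<open>c i t\<close> at every \<open>t\<close> does not exclude
    infimum 0 for an almost periodic function; a positive infimum follows from dominance over a
    nonnegative sum.\<close>
  have c0_pos: "0 < c0 i" if i: "i < N" for i
  proof -
    have "0 \<le> (\<Sum>l<M. \<Sum>j<N. A i j l * (L j * \<xi> j))"
      using i by (intro sum_nonneg mult_nonneg_nonneg A0 less_imp_le[OF L_pos] less_imp_le[OF \<xi>]) auto
    then have "0 < c0 i * \<xi> i" using dominant[OF i] by linarith
    then show ?thesis using \<xi>[OF i] by (simp add: zero_less_mult_iff)
  qed
  have G_lip: "\<bar>G j x - G j y\<bar> \<le> L j * \<bar>x - y\<bar>"
    if j: "j < N" and x: "s j * p j \<le> s j * x" and y: "s j * p j \<le> s j * y" for j x y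
  proof -
    have mono: "s j * (\<sigma> j * p j) \<le> s j * (\<sigma> j * w)" if "s j * p j \<le> s j * w" for w
      using mult_left_mono[OF that, of "\<sigma> j"] H1_sigma[OF j] by (simp add: mult_ac)
    have "0 < s j * (\<sigma> j * p j)"
      using mult_pos_pos[OF H1_sigma[OF j] sp[OF j]] by (simp add: mult_ac)
    then have "\<bar>G j x - G j y\<bar> \<le> deriv (g j) (\<sigma> j * p j) * \<bar>\<sigma> j * x - \<sigma> j * y\<bar>"
      unfolding G_def using class_A_lipschitz_tail[OF g_class_A[OF j] s_sign _ mono[OF x] mono[OF y]] by blast
    also have "\<dots> \<le> \<gamma> j * \<bar>\<sigma> j * x - \<sigma> j * y\<bar>"
      by (intro mult_right_mono) (auto simp: \<gamma>_def p_def)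
    also have "\<dots> = L j * \<bar>x - y\<bar>"
      using H1_sigma[OF j] by (simp add: L_def abs_mult flip: right_diff_distrib)
    finally show ?thesis .
  qed
  \<comment> \<open>Multiplied by \<open>s i\<close>, the equation for \<open>\<beta> i\<close> or
    \<open>\<alpha> i\<close> is the worst case of this inequality. Since
    \<open>s i * p i > 0\<close>, replacing \<open>c i t\<close> by its supremum only raises the
    left side; since \<open>s i * G i (p i) \<ge> 0\<close> and the own inputs lie beyond
    \<open>G i (p i)\<close>, passing to that value and to the infimum of the diagonal coefficients
    only lowers the right side. The other inputs and \<open>J\<close> are replaced by their
    unfavourable extremes.\<close>
  have inward: "c i t * (s i * p i) \<le> s i * ((\<Sum>l<M. \<Sum>j<N. a i j l t * y j l) + J i t)"
    if i: "i < N" and yB: "\<And>j l. j < N \<Longrightarrow> l < M \<Longrightarrow> \<bar>y j l\<bar> \<le> B j"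
      and yi: "\<And>l. l < M \<Longrightarrow> \<exists>x. s i * p i \<le> s i * x \<and> y i l = G i x" for i t and y :: "nat \<Rightarrow> nat \<Rightarrow> real"
  proof -
    let ?a = "INF t. \<Sum>l<M. a i i l t" and ?D = "\<Sum>l<M. \<Sum>j\<in>{..<N} - {i}. a i j l t * y j l"
    have split: "(\<Sum>l<M. \<Sum>j<N. a i j l t * y j l) = (\<Sum>l<M. a i i l t * y i l) + ?D"
      unfolding sum.distrib[symmetric] by (intro sum.cong refl sum.remove) (use i in auto)
    have Gp: "0 \<le> s i * G i (p i)"
    proof -
      have "g i 0 = 0" using g_class_A[OF i] by (simp add: class_A_def)
      then show ?thesis
        using class_A_mono[OF g_class_A[OF i], of 0 "\<sigma> i * p i"] class_A_mono[OF g_class_A[OF i], of "\<sigma> i * p i" 0]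
          sp[OF i] H1_sigma[OF i] s_sign[of i]
        by (auto simp: G_def mult_le_0_iff)
    qed
    have yGp: "s i * G i (p i) \<le> s i * y i l" if l: "l < M" for l
    proof -
      obtain x where x: "s i * p i \<le> s i * x" "y i l = G i x" using yi[OF l] by blast
      then show ?thesis
        using s_sign[of i] H1_sigma[OF i]
        by (auto simp: G_def intro!: class_A_mono[OF g_class_A[OF i]])
    qed
    have "?a \<le> (\<Sum>l<M. a i i l t)"
      by (intro cINF_lower bdd_belowI[of _ 0]) (auto intro!: sum_nonneg less_imp_le[OF H1_diag] i)
    then have "?a * (s i * G i (p i)) \<le> (\<Sum>l<M. a i i l t) * (s i * G i (p i))"
      by (rule mult_right_mono[OF _ Gp])
    also have "\<dots> \<le> (\<Sum>l<M. a i i l t * (s i * y i l))"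
      unfolding sum_distrib_right
      by (rule sum_mono, rule mult_left_mono) (use yGp H1_diag[OF i] in \<open>auto simp: less_imp_le\<close>)
    also have "\<dots> = s i * (\<Sum>l<M. a i i l t * y i l)" by (simp add: sum_distrib_left mult_ac)
    finally have diag: "?a * (s i * G i (p i)) \<le> s i * (\<Sum>l<M. a i i l t * y i l)" .
    have "\<bar>?D\<bar> \<le> coupling_bound N M a B i"
      unfolding coupling_bound_def
    proof (intro sum_abs[THEN order_trans] sum_mono)
      fix l j assume "l \<in> {..<M}" "j \<in> {..<N} - {i}"
      then have jl: "j < N" "l < M" by auto
      show "\<bar>a i j l t * y j l\<bar> \<le> (SUP t. \<bar>a i j l t\<bar>) * B j"
        unfolding abs_mult using A_ge[OF i jl] A0[OF i jl] unfolding A_def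
        by (intro mult_mono yB jl) auto
    qed
    then have off: "- coupling_bound N M a B i \<le> s i * ?D" using s_sign[of i] by auto
    have "c i t * (s i * p i) \<le> (SUP t. c i t) * (s i * p i)"
      using bnd H1_c[OF i] sp[OF i] by (intro mult_right_mono cSUP_upper) auto
    also have "\<dots> \<le> ?a * (s i * G i (p i)) - coupling_bound N M a B i + s i * J i t"
    proof (cases "sel i = 1")
      case True
      have "J i t \<le> (SUP t. J i t)" using bnd[OF H1_J[OF i]] by (intro cSUP_upper) auto
      then show ?thesis using True beta[OF i] by (simp add: s_def p_def G_def aux_F_def)
    next
      case False
      have "(INF t. J i t) \<le> J i t" using bnd[OF H1_J[OF i]] by (intro cINF_lower) auto
      then show ?thesis using False alpha[OF i] by (simp add: s_def p_def G_def aux_F_def)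
    qed
    also have "\<dots> \<le> s i * ((\<Sum>l<M. \<Sum>j<N. a i j l t * y j l) + J i t)"
      unfolding split using diag off by (simp add: distrib_left)
    finally show ?thesis .
  qed
  have \<kappa>_le: "\<kappa> i j l t \<le> r" if "i < N" "j < N" "l < M" for i j l t
    using delay_bounds[OF that, of t] le_max_delay[OF that, of \<kappa>b] by (simp add: r_def)
  have r_pos: "0 < r"
    using \<kappa>_le[of 0 0 0 0] delay_bounds[of 0 0 0 0] \<open>N \<ge> 1\<close> \<open>M \<ge> 1\<close> by auto
  interpret delay_network N M c J a \<kappa> G r c0 B L \<xi> s p A
  proof
    show "\<exists>K. \<forall>t. \<bar>J i t\<bar> \<le> K" if "i < N" for i by (rule almost_periodic_bounded[OF H1_J[OF that]])
    show "\<bar>G j x\<bar> \<le> B j" if "j < N" for j x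
      using g_class_A[OF that] by (simp add: class_A_def G_def)
  qed (use cont H1_c H1_a H1_kappa H1_J c0_le c0_pos A_ge delay_bounds \<kappa>_le G_lip L_pos r_pos s_sign \<xi> dominant inward
      in \<open>auto simp: less_imp_le\<close>)
  show ?thesis
    unfolding r_def[symmetric]
  proof (rule unique_stable_ap_solution[OF \<open>N \<ge> 1\<close>])
    show "gnn_rhs N M c a \<kappa> \<sigma> g J u i t = - c i t * u i t + input u i t" for u i t
      by (simp add: gnn_rhs_def input_def G_def)
    show "basin N r \<beta> \<alpha> sel = {\<phi>. \<forall>i<N. continuous_on {-r..0} (\<phi> i) \<and> (\<forall>x\<in>{-r..0}. in_region i (\<phi> i x))}"
      by (simp add: basin_def basin1_def basin2_def in_region_def s_def p_def if_distrib)
  qed (use H1_c H1_a H1_kappa H1_J in auto)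
qed

end
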